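(* For every weight $w$ on $\mathbb{R}^n$ and every $p>1$, $$[w]_{C_p}\ \approx\ \sup_{f:\ \|f\|_{\mathrm{BMO}}=1}\ \sup_{Q}\ \frac{1}{\int_{\mathbb{R}^n}M(\chi_Q)^p\,w\,dx}\int_Q|f(x)-f_Q|\,w(x)\,dx,$$ that is, each side is bounded by a constant depending only on $n$ times the other.
   Context: A weight is a non-negative locally integrable function on $\mathbb{R}^n$, here assumed not a.e. zero. Cubes have sides parallel to the axes. For $f\in L^1_{loc}(\mathbb{R}^n)$, $f_Q=\frac{1}{|Q|}\int_Q f$ and $\|f\|_{\mathrm{BMO}}=\sup_Q\frac{1}{|Q|}\int_Q|f-f_Q|\,dx$. $M$ is the Hardy–Littlewood maximal operator $Mg(x)=\sup_{R\ni x}\frac{1}{|R|}\int_R|g|$ (supremum over cubes $R$ containing $x$). The $C_p$ constant is $$[w]_{C_p}=\sup_Q\frac{1}{\int_{\mathbb{R}^n}M(\chi_Q)^p\,w\,dx}\int_Q M(w\chi_Q)\,dx.$$ It is assumed that $\int_{\mathbb{R}^n}M(\chi_Q)^p\,w\,dx<\infty$ for every cube $Q$, so that $Y(Q)=\int_{\mathbb{R}^n}M(\chi_Q)^p\,w\,dx$ takes values in $(0,\infty)$. The suprema may equal $+\infty$. *)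

theory Defs
  imports "HOL-Analysis.Analysis"
begin

text \<open>
  Integrals are taken with respect to Lebesgue measure on \<open>real ^ 'n\<close>. Integrals of non-negative
  functions, and the suprema built from them, live in \<^typ>\<open>ennreal\<close>, so that they may be infinite.
\<close>

definition cube :: "(real ^ 'n) set \<Rightarrow> bool" where
  "cube Q \<longleftrightarrow> (\<exists>a l. l > 0 \<and> Q = cbox a (\<chi> i. a $ i + l))"

definition locally_integrable :: "(real ^ 'n \<Rightarrow> real) \<Rightarrow> bool" where
  "locally_integrable f \<longleftrightarrow> (\<forall>K. compact K \<longrightarrow> set_integrable lebesgue K f)"

definition weight :: "(real ^ 'n \<Rightarrow> real) \<Rightarrow> bool" where
  "weight w \<longleftrightarrow> locally_integrable w \<and> (\<forall>x. 0 \<le> w x) \<and> \<not> (AE x in lebesgue. w x = 0)"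

definition average :: "(real ^ 'n \<Rightarrow> real) \<Rightarrow> (real ^ 'n) set \<Rightarrow> real" where
  "average f Q = (LINT x:Q|lebesgue. f x) / measure lebesgue Q"

definition bmo_norm :: "(real ^ 'n \<Rightarrow> real) \<Rightarrow> ennreal" where
  "bmo_norm f = (SUP Q \<in> {Q. cube Q}.
     (\<integral>\<^sup>+x\<in>Q. ennreal \<bar>f x - average f Q\<bar> \<partial>lebesgue) / emeasure lebesgue Q)"

definition hl_maximal :: "(real ^ 'n \<Rightarrow> real) \<Rightarrow> real ^ 'n \<Rightarrow> ennreal" where
  "hl_maximal g x = (SUP R \<in> {R. cube R \<and> x \<in> R}.
     (\<integral>\<^sup>+y\<in>R. ennreal \<bar>g y\<bar> \<partial>lebesgue) / emeasure lebesgue R)"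

text \<open>
  The integral of \<open>(M \<chi>\<^sub>Q)\<^sup>p w\<close>. There is no real power on \<^typ>\<open>ennreal\<close>; passing through
  \<^const>\<open>enn2real\<close> loses nothing because \<open>M \<chi>\<^sub>Q \<le> 1\<close>.
\<close>

definition cp_mass :: "real \<Rightarrow> (real ^ 'n \<Rightarrow> real) \<Rightarrow> (real ^ 'n) set \<Rightarrow> ennreal" where
  "cp_mass p w Q =
     (\<integral>\<^sup>+x. ennreal (enn2real (hl_maximal (indicator Q) x) powr p * w x) \<partial>lebesgue)"

definition cp_const :: "real \<Rightarrow> (real ^ 'n \<Rightarrow> real) \<Rightarrow> ennreal" where
  "cp_const p w = (SUP Q \<in> {Q. cube Q}.
     1 / cp_mass p w Q * (\<integral>\<^sup>+x\<in>Q. hl_maximal (\<lambda>y. w y * indicator Q y) x \<partial>lebesgue))"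

definition cp_bmo_const :: "real \<Rightarrow> (real ^ 'n \<Rightarrow> real) \<Rightarrow> ennreal" where
  "cp_bmo_const p w = (SUP f \<in> {f. locally_integrable f \<and> bmo_norm f = 1}. SUP Q \<in> {Q. cube Q}.
     1 / cp_mass p w Q * (\<integral>\<^sup>+x\<in>Q. ennreal (\<bar>f x - average f Q\<bar> * w x) \<partial>lebesgue))"

end

theory Submission
  imports Defs
begin

text \<open>
  Both suprema range over cubes \<open>Q\<close> and carry the same factor \<open>1 / \<integral> (M \<chi>\<^sub>Q)\<^sup>p w\<close>. The theorem
  therefore follows from two estimates on one cube \<open>Q\<close>, where \<open>F = M (w \<chi>\<^sub>Q)\<close>. In one direction
  \<open>\<integral>\<^sub>Q |f - f\<^sub>Q| w \<le> C \<integral>\<^sub>Q F\<close> for every \<open>f\<close> of BMO norm at most one. In the other direction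
  \<open>\<integral>\<^sub>Q F\<close> is bounded by the weighted oscillations over \<open>Q\<close> of two functions whose BMO norms are
  bounded by constants depending only on the dimension.

  To bound \<open>\<integral>\<^sub>Q F\<close> from above, let \<open>a\<close> be the average of \<open>w\<close> over \<open>Q\<close>. The classical test function
  is \<open>log F\<close>, which is in BMO by Coifman and Rochberg, and the bound is then Wiener's
  \<open>L log L\<close> estimate. A discrete substitute for the logarithm makes every step a
  geometric series: let \<open>N\<close> count the levels \<open>2\<^sup>k a\<close>, \<open>k \<ge> 0\<close>, lying below \<open>F\<close>. Summing the weak
  type inequality \<open>t |{F > t}| \<le> K \<integral>\<^bsub>{F > t}\<^esub> w \<chi>\<^sub>Q\<close> over these levels gives
  \<open>\<integral> N \<le> 2 K |Q|\<close> and \<open>\<integral>\<^sub>Q F \<le> w(Q) + 2 K \<integral>\<^sub>Q N w\<close> (\<open>nn_integral_level_count_le\<close>,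
  \<open>nn_integral_hl_maximal_le\<close>). A local version of the inequality, which bounds
  \<open>t |{y \<in> R. F y > t}|\<close> by a multiple of \<open>|R|\<close> times the infimum of \<open>F\<close> over \<open>R\<close>, shows in the same way that
  \<open>N\<close> is in BMO (\<open>level_count_oscillation\<close>). Since \<open>N\<^sub>Q \<le> 2 K\<close>, the integral of \<open>N w\<close> is the
  oscillation of \<open>N\<close> plus a multiple of \<open>w(Q)\<close>. Finally \<open>w(Q)\<close> is itself twice an oscillation,
  that of the indicator of a half space bisecting \<open>Q\<close>.

  For the opposite estimate, run the stopping time argument of John and Nirenberg against
  the weight. Select the maximal dyadic subcubes \<open>R\<close> of \<open>Q\<close> with \<open>|f\<^sub>R - f\<^sub>Q| > 2\<close>. They fill at most
  half of \<open>Q\<close>. Off them \<open>|f - f\<^sub>Q| \<le> 2\<close>, and on each of them \<open>|f - f\<^sub>Q| \<le> 2 + 2\<^sup>n + |f - f\<^sub>R|\<close>. As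
  the average of \<open>w\<close> over \<open>Q\<close> is at most \<open>F\<close> everywhere on \<open>Q\<close>, the contribution \<open>(2 + 2\<^sup>n) w(Q)\<close> is
  absorbed by the integral of \<open>F\<close> over the half of \<open>Q\<close> that was not selected. The selected
  cubes are treated recursively, each with its own part of \<open>F\<close>, so the constant
  does not grow. To make the recursion finite, \<open>f\<close> is replaced by its dyadic averages of
  generation \<open>k\<close> (\<open>dyadic_oscillation_le\<close>). The limit \<open>k \<rightarrow> \<infinity>\<close> uses Fatou's lemma and the
  Lebesgue differentiation theorem for cubes.
\<close>

section \<open>Cubes and a Vitali covering lemma\<close>

abbreviation ccube :: "real ^ 'n \<Rightarrow> real \<Rightarrow> (real ^ 'n) set" where
  "ccube a l \<equiv> cbox a (\<chi> i. a $ i + l)"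

lemma mem_ccube: "x \<in> ccube a l \<longleftrightarrow> (\<forall>i. a $ i \<le> x $ i \<and> x $ i \<le> a $ i + l)"
  by (simp add: mem_box_cart)

lemma cube_ccube: "l > 0 \<Longrightarrow> cube (ccube a l)"
  unfolding cube_def by blast

lemma measure_ccube: "0 \<le> l \<Longrightarrow> measure lebesgue (ccube a l :: (real ^ 'n) set) = l ^ CARD('n)"
  by (simp add: content_cbox_cart interval_eq_empty_cart not_less)

lemma emeasure_ccube:
  "0 \<le> l \<Longrightarrow> emeasure lebesgue (ccube a l :: (real ^ 'n) set) = ennreal (l ^ CARD('n))"
  using emeasure_eq_measure2[OF lmeasurable_cbox] by (metis measure_ccube)

lemma emeasure_lborel_ccube:
  "0 \<le> l \<Longrightarrow> emeasure lborel (ccube a l :: (real ^ 'n) set) = ennreal (l ^ CARD('n))"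
  using emeasure_ccube[of l a] by simp

text \<open>
  The covering lemma selects balls of radius \<open>n l\<close> around cubes of side \<open>l\<close> and dilates them by 5.
  The result fits into a cube of side \<open>10 n l\<close>, which exceeds the original volume by this factor.
\<close>

definition vitali_const :: "'n::finite itself \<Rightarrow> real" where
  "vitali_const _ = (10 * real CARD('n)) ^ CARD('n)"

lemma vitali_const_ge_1: "1 \<le> vitali_const TYPE('n::finite)"
proof -
  have "CARD('n) \<ge> 1" using zero_less_card_finite[where 'a='n] by linarith
  then show ?thesis unfolding vitali_const_def by (intro one_le_power) linarith
qed

text \<open>
  The ball version of the covering lemma is applied to the balls circumscribed about the cubes:
  disjoint balls contain disjoint cubes, and the dilated balls are comparable in volume to the cubes.
\<close>

lemma vitali_cubes:
  fixes I :: "((real ^ 'n) \<times> real) set"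
  assumes I: "\<And>a l. (a, l) \<in> I \<Longrightarrow> 0 < l \<and> l \<le> B"
  obtains C T where "countable C" "C \<subseteq> I" "disjoint_family_on (\<lambda>(a, l). ccube a l) C"
    "T \<in> sets lebesgue" "(\<Union>(a, l)\<in>I. ccube a l) \<subseteq> T"
    "emeasure lebesgue T
       \<le> ennreal (vitali_const TYPE('n)) * emeasure lebesgue (\<Union>(a, l)\<in>C. ccube a l)"
proof -
  let ?n = "real CARD('n)"
  have n: "?n \<ge> 1" using zero_less_card_finite[where 'a='n] by linarith
  define c where "c = (\<lambda>(a :: real ^ 'n, l). (\<chi> i. a $ i + l / 2))"
  define r where "r = (\<lambda>(a :: real ^ 'n, l). ?n * l)"
  have sub: "ccube a l \<subseteq> cball (c (a, l)) (r (a, l))" if "l > 0" for a l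
  proof
    fix x assume "x \<in> ccube a l"
    then have *: "a $ i \<le> x $ i \<and> x $ i \<le> a $ i + l" for i by (auto simp: mem_ccube)
    have "norm (c (a, l) - x) \<le> (\<Sum>i\<in>UNIV. \<bar>(c (a, l) - x) $ i\<bar>)"
      by (rule norm_le_l1_cart)
    also have "\<dots> \<le> (\<Sum>i\<in>(UNIV :: 'n set). l)"
    proof (rule sum_mono)
      show "\<bar>(c (a, l) - x) $ i\<bar> \<le> l" for i
        using *[of i] by (simp add: c_def abs_le_iff field_simps)
    qed
    finally show "x \<in> cball (c (a, l)) (r (a, l))" by (simp add: r_def dist_norm)
  qed
  have cov: "(\<Union>(a, l)\<in>I. ccube a l) \<subseteq> (\<Union>i\<in>I. cball (c i) (r i))"
  proof clarify
    fix x a l assume "(a, l) \<in> I" "x \<in> ccube a l"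
    then show "x \<in> (\<Union>i\<in>I. cball (c i) (r i))"
      using sub[of l a] I[of a l] by blast
  qed
  have rB: "0 < r i \<and> r i \<le> ?n * B" if "i \<in> I" for i
    using I[of "fst i" "snd i"] that n by (cases i) (simp add: r_def)
  obtain C where C: "countable C" "C \<subseteq> I"
     "pairwise (\<lambda>i j. disjnt (cball (c i) (r i)) (cball (c j) (r j))) C"
     "(\<Union>(a, l)\<in>I. ccube a l) \<subseteq> (\<Union>i\<in>C. cball (c i) (5 * r i))"
    using Vitali_covering_lemma_cballs[OF cov rB] by blast
  define T where "T = (\<Union>i\<in>C. cball (c i) (5 * r i))"
  have disj: "disjoint_family_on (\<lambda>(a, l). ccube a l) C"
    unfolding disjoint_family_on_def
  proof (intro ballI impI)
    fix i j assume "i \<in> C" "j \<in> C" "i \<noteq> j"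
    then have "disjnt (cball (c i) (r i)) (cball (c j) (r j))" using C(3) by (auto simp: pairwise_def)
    moreover have "(case i of (a, l) \<Rightarrow> ccube a l) \<subseteq> cball (c i) (r i)"
      using sub[of "snd i" "fst i"] I[of "fst i" "snd i"] \<open>i \<in> C\<close> C(2)
      by (cases i) (simp add: subset_iff)
    moreover have "(case j of (a, l) \<Rightarrow> ccube a l) \<subseteq> cball (c j) (r j)"
      using sub[of "snd j" "fst j"] I[of "fst j" "snd j"] \<open>j \<in> C\<close> C(2)
      by (cases j) (simp add: subset_iff)
    ultimately show "(case i of (a, l) \<Rightarrow> ccube a l) \<inter> (case j of (a, l) \<Rightarrow> ccube a l) = {}"
      by (auto simp: disjnt_def)
  qed
  have Tsets: "T \<in> sets lebesgue"
    unfolding T_def using C(1) by (intro sets.countable_UN') auto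
  have one: "emeasure lebesgue (cball (c i) (5 * r i))
      \<le> ennreal (vitali_const TYPE('n)) * emeasure lebesgue (case i of (a, l) \<Rightarrow> ccube a l)"
    if "i \<in> C" for i
  proof -
    obtain a l where i: "i = (a, l)" by (cases i)
    have l: "l > 0" using I that C(2) i by auto
    let ?b = "\<chi> i. c (a, l) $ i - 5 * ?n * l"
    have "cball (c i) (5 * r i) \<subseteq> ccube ?b (10 * ?n * l)"
    proof
      fix x assume "x \<in> cball (c i) (5 * r i)"
      then have "norm (c (a, l) - x) \<le> 5 * ?n * l" by (simp add: i r_def dist_norm)
      then have "\<bar>c (a, l) $ j - x $ j\<bar> \<le> 5 * ?n * l" for j
        using component_le_norm_cart[of "c (a, l) - x" j] by simp
      then show "x \<in> ccube ?b (10 * ?n * l)"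
        unfolding mem_ccube by (auto simp: abs_le_iff algebra_simps)
    qed
    then have "emeasure lebesgue (cball (c i) (5 * r i)) \<le> emeasure lebesgue (ccube ?b (10 * ?n * l))"
      by (intro emeasure_mono) auto
    also have "\<dots> = ennreal ((10 * ?n * l) ^ CARD('n))"
      using l n by (intro emeasure_ccube) auto
    also have "\<dots> = ennreal (vitali_const TYPE('n)) * emeasure lebesgue (ccube a l)"
      using l n by (subst emeasure_ccube) (auto simp: vitali_const_def power_mult_distrib ennreal_mult)
    finally show ?thesis by (simp add: i)
  qed
  \<comment> \<open>Reindexing by natural numbers turns countable subadditivity and additivity into statements on series.\<close>
  define A where "A = (\<lambda>k. if k \<in> to_nat_on C ` C then
      cball (c (from_nat_into C k)) (5 * r (from_nat_into C k)) else {})"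
  define D where "D = (\<lambda>k. if k \<in> to_nat_on C ` C then
      (case from_nat_into C k of (a, l) \<Rightarrow> ccube a l) else {})"
  have "T = (\<Union>k. A k)"
  proof -
    have "(\<Union>k. A k) = (\<Union>k\<in>to_nat_on C ` C. A k)" by (auto simp: A_def)
    also have "\<dots> = T" using C(1) by (simp add: A_def T_def)
    finally show ?thesis by simp
  qed
  then have "emeasure lebesgue T \<le> (\<Sum>k. emeasure lebesgue (A k))"
    by (simp only:) (intro emeasure_subadditive_countably, auto simp: A_def)
  also have "\<dots> \<le> (\<Sum>k. ennreal (vitali_const TYPE('n)) * emeasure lebesgue (D k))"
    using one C(1) by (intro suminf_le) (auto simp: A_def D_def)
  also have "\<dots> = ennreal (vitali_const TYPE('n)) * (\<Sum>k. emeasure lebesgue (D k))"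
    by simp
  also have "(\<Sum>k. emeasure lebesgue (D k)) = emeasure lebesgue (\<Union>k. D k)"
  proof (rule suminf_emeasure)
    show "range D \<subseteq> sets lebesgue" by (auto simp: D_def split: prod.splits)
    show "disjoint_family D"
      unfolding disjoint_family_on_def
    proof (intro ballI impI)
      fix j k :: nat assume "j \<noteq> k"
      show "D j \<inter> D k = {}"
      proof (cases "j \<in> to_nat_on C ` C \<and> k \<in> to_nat_on C ` C")
        case True
        then obtain u v where "u \<in> C" "v \<in> C" "j = to_nat_on C u" "k = to_nat_on C v" by auto
        then show ?thesis using disj \<open>j \<noteq> k\<close> C(1) by (auto simp: D_def disjoint_family_on_def)
      qed (auto simp: D_def)
    qed
  qed
  also have "(\<Union>k. D k) = (\<Union>(a, l)\<in>C. ccube a l)"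
  proof -
    have "(\<Union>k. D k) = (\<Union>k\<in>to_nat_on C ` C. D k)" by (auto simp: D_def)
    also have "\<dots> = (\<Union>(a, l)\<in>C. ccube a l)" using C(1) by (simp add: D_def)
    finally show ?thesis by simp
  qed
  finally show thesis
    using that[OF C(1,2) disj Tsets] C(4) by (simp add: T_def)
qed

section \<open>The weak type inequality for the maximal operator\<close>

lemma less_divide_ennreal: "c > 0 \<Longrightarrow> t < I / ennreal c \<longleftrightarrow> t * ennreal c < I"
  by (cases t; cases I)
     (auto simp: divide_ennreal ennreal_mult[symmetric] ennreal_less_iff field_simps
       ennreal_top_mult ennreal_top_divide)

lemma less_hl_maximal_iff:
  fixes g :: "real ^ 'n \<Rightarrow> real"
  shows "t < hl_maximal g x \<longleftrightarrow> (\<exists>a l. l > 0 \<and> x \<in> ccube a l \<and>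
     t * ennreal (l ^ CARD('n)) < (\<integral>\<^sup>+y\<in>ccube a l. ennreal \<bar>g y\<bar> \<partial>lebesgue))"
proof
  assume "t < hl_maximal g x"
  then obtain R where "cube R" "x \<in> R"
      and t: "t < (\<integral>\<^sup>+y\<in>R. ennreal \<bar>g y\<bar> \<partial>lebesgue) / emeasure lebesgue R"
    by (auto simp: hl_maximal_def less_SUP_iff)
  then obtain a l where R: "l > 0" "R = ccube a l" by (auto simp: cube_def)
  show "\<exists>a l. l > 0 \<and> x \<in> ccube a l \<and>
     t * ennreal (l ^ CARD('n)) < (\<integral>\<^sup>+y\<in>ccube a l. ennreal \<bar>g y\<bar> \<partial>lebesgue)"
    using t R \<open>x \<in> R\<close> by (intro exI[of _ a] exI[of _ l]) (simp add: emeasure_lborel_ccube less_divide_ennreal)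
next
  assume "\<exists>a l. l > 0 \<and> x \<in> ccube a l \<and>
     t * ennreal (l ^ CARD('n)) < (\<integral>\<^sup>+y\<in>ccube a l. ennreal \<bar>g y\<bar> \<partial>lebesgue)"
  then obtain a l where *: "l > 0" "x \<in> ccube a l"
     "t * ennreal (l ^ CARD('n)) < (\<integral>\<^sup>+y\<in>ccube a l. ennreal \<bar>g y\<bar> \<partial>lebesgue)" by blast
  show "t < hl_maximal g x"
    unfolding hl_maximal_def less_SUP_iff
    using * by (intro bexI[of _ "ccube a l"])
      (auto simp: emeasure_lborel_ccube less_divide_ennreal cube_ccube)
qed

lemma average_le_hl_maximal:
  fixes g :: "real ^ 'n \<Rightarrow> real"
  assumes "l > 0" "x \<in> ccube a l"
  shows "(\<integral>\<^sup>+y\<in>ccube a l. ennreal \<bar>g y\<bar> \<partial>lebesgue) \<le> ennreal (l ^ CARD('n)) * hl_maximal g x"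
proof (rule ccontr)
  assume "\<not> ?thesis"
  then have "hl_maximal g x < hl_maximal g x"
    using assms by (subst less_hl_maximal_iff) (auto simp: mult.commute not_le)
  then show False by simp
qed

text \<open>
  A cube through \<open>x\<close> on which the average exceeds \<open>t\<close> can be enlarged slightly without losing this
  property, and the enlarged cube serves all points near \<open>x\<close>. This yields the measurability of the
  maximal function.
\<close>

lemma open_hl_maximal_greater:
  fixes g :: "real ^ 'n \<Rightarrow> real"
  shows "open {x. t < hl_maximal g x}"
  unfolding open_contains_ball
proof clarify
  fix x assume "t < hl_maximal g x"
  then obtain a l where *: "l > 0" "x \<in> ccube a l"
     "t * ennreal (l ^ CARD('n)) < (\<integral>\<^sup>+y\<in>ccube a l. ennreal \<bar>g y\<bar> \<partial>lebesgue)"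
    by (auto simp: less_hl_maximal_iff)
  obtain r where r: "t = ennreal r" "r \<ge> 0"
    using * by (cases t) (auto simp: ennreal_top_mult)
  have "((\<lambda>d. r * (l + 2 * d) ^ CARD('n)) \<longlongrightarrow> r * (l + 2 * 0) ^ CARD('n)) (at_right 0)"
    by (intro tendsto_intros)
  then have "((\<lambda>d. ennreal (r * (l + 2 * d) ^ CARD('n))) \<longlongrightarrow> ennreal (r * (l + 2 * 0) ^ CARD('n))) (at_right 0)"
    by (rule tendsto_ennrealI)
  moreover have "ennreal (r * (l + 2 * 0) ^ CARD('n)) < (\<integral>\<^sup>+y\<in>ccube a l. ennreal \<bar>g y\<bar> \<partial>lebesgue)"
    using * r by (simp add: ennreal_mult)
  ultimately have "eventually (\<lambda>d. ennreal (r * (l + 2 * d) ^ CARD('n)) <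
      (\<integral>\<^sup>+y\<in>ccube a l. ennreal \<bar>g y\<bar> \<partial>lebesgue)) (at_right 0)"
    by (rule order_tendstoD(2))
  then obtain d0 where "d0 > 0" and d0: "\<And>d. 0 < d \<Longrightarrow> d < d0 \<Longrightarrow> ennreal (r * (l + 2 * d) ^ CARD('n)) <
      (\<integral>\<^sup>+y\<in>ccube a l. ennreal \<bar>g y\<bar> \<partial>lebesgue)"
    by (auto simp: eventually_at_right_field)
  define d where "d = d0 / 2"
  have d: "d > 0" "ennreal (r * (l + 2 * d) ^ CARD('n)) <
      (\<integral>\<^sup>+y\<in>ccube a l. ennreal \<bar>g y\<bar> \<partial>lebesgue)"
    using d0[of d] \<open>d0 > 0\<close> by (auto simp: d_def)
  let ?b = "\<chi> i. a $ i - d"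
  have sub: "ccube a l \<subseteq> ccube ?b (l + 2 * d)"
    unfolding subset_iff mem_ccube using d(1) by (auto simp: algebra_simps) (smt (verit))+
  have big: "t * ennreal ((l + 2 * d) ^ CARD('n)) <
      (\<integral>\<^sup>+y\<in>ccube ?b (l + 2 * d). ennreal \<bar>g y\<bar> \<partial>lebesgue)"
    using less_le_trans[OF d(2) nn_set_integral_set_mono[OF sub]] r *(1) d(1) by (simp add: ennreal_mult)
  have "ball x d \<subseteq> {x. t < hl_maximal g x}"
  proof clarify
    fix y assume "y \<in> ball x d"
    then have n: "norm (x - y) < d" by (simp add: dist_norm)
    have y: "\<bar>x $ i - y $ i\<bar> < d" for i
      using le_less_trans[OF component_le_norm_cart[of "x - y" i] n] by simp
    have "y \<in> ccube ?b (l + 2 * d)"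
      unfolding mem_ccube
    proof
      fix i
      show "(\<chi> i. a $ i - d) $ i \<le> y $ i \<and> y $ i \<le> (\<chi> i. a $ i - d) $ i + (l + 2 * d)"
        using y[of i] *(2)[unfolded mem_ccube, rule_format, of i] by (simp add: abs_less_iff)
    qed
    then show "t < hl_maximal g y"
      unfolding less_hl_maximal_iff using big *(1) d(1)
      by (intro exI[of _ ?b] exI[of _ "l + 2 * d"]) simp
  qed
  then show "\<exists>e>0. ball x e \<subseteq> {x. t < hl_maximal g x}" using d(1) by blast
qed

lemma sets_hl_maximal_greater: "{x. t < hl_maximal g x} \<in> sets lebesgue"
  by (rule sets_completionI_sets) (simp add: borel_open open_hl_maximal_greater)

lemma borel_measurable_hl_maximal [measurable]: "hl_maximal g \<in> borel_measurable lebesgue"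
  by (rule borel_measurableI_greater) (simp add: sets_hl_maximal_greater)

text \<open>
  The integral on the right extends over the level set and not over the whole space. This is
  automatic, since the level set is the union of all cubes with large average and so contains the
  cubes selected by the covering lemma. It is this form that gives the \<open>L log L\<close> estimate
  without comparing \<open>|g|\<close> to its maximal function pointwise.
\<close>

theorem hl_maximal_weak_type:
  fixes g :: "real ^ 'n \<Rightarrow> real"
  assumes g [measurable]: "g \<in> borel_measurable lebesgue"
    and fin: "(\<integral>\<^sup>+x. ennreal \<bar>g x\<bar> \<partial>lebesgue) < \<infinity>" and "t > 0"
  shows "ennreal t * emeasure lebesgue {x. ennreal t < hl_maximal g x}
     \<le> ennreal (vitali_const TYPE('n)) *
        (\<integral>\<^sup>+x\<in>{x. ennreal t < hl_maximal g x}. ennreal \<bar>g x\<bar> \<partial>lebesgue)"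
proof -
  define U where "U = {x. ennreal t < hl_maximal g x}"
  have U [measurable]: "U \<in> sets lebesgue" unfolding U_def by (rule sets_hl_maximal_greater)
  define \<mu> where "\<mu> = density lebesgue (\<lambda>x. ennreal \<bar>g x\<bar>)"
  have \<mu>: "emeasure \<mu> A = (\<integral>\<^sup>+x\<in>A. ennreal \<bar>g x\<bar> \<partial>lebesgue)" if "A \<in> sets lebesgue" for A
    unfolding \<mu>_def using that by (subst emeasure_density) auto
  obtain G where G: "(\<integral>\<^sup>+x. ennreal \<bar>g x\<bar> \<partial>lebesgue) = ennreal G" "G \<ge> 0"
    using fin by (cases "\<integral>\<^sup>+x. ennreal \<bar>g x\<bar> \<partial>lebesgue") auto
  define I where "I = {(a, l). l > 0 \<and>
     ennreal t * ennreal (l ^ CARD('n)) < (\<integral>\<^sup>+y\<in>ccube a l. ennreal \<bar>g y\<bar> \<partial>lebesgue)}"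
  have UI: "U = (\<Union>(a, l)\<in>I. ccube a l)"
    unfolding U_def I_def less_hl_maximal_iff by blast
  have bdd: "0 < l \<and> l \<le> 1 + G / t" if "(a, l) \<in> I" for a l
  proof -
    have l: "l > 0" "ennreal t * ennreal (l ^ CARD('n)) < (\<integral>\<^sup>+y\<in>ccube a l. ennreal \<bar>g y\<bar> \<partial>lebesgue)"
      using that by (auto simp: I_def)
    note l(2)
    also have "(\<integral>\<^sup>+y\<in>ccube a l. ennreal \<bar>g y\<bar> \<partial>lebesgue) \<le> ennreal G"
      unfolding G(1)[symmetric] by (intro nn_integral_mono) (auto split: split_indicator)
    finally have "ennreal (t * l ^ CARD('n)) < ennreal G"
      using l(1) \<open>t > 0\<close> by (simp add: ennreal_mult)
    then have "l ^ CARD('n) < G / t"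
      using l(1) \<open>t > 0\<close> by (simp add: ennreal_less_iff field_simps)
    moreover have "l \<le> l ^ CARD('n)" if "l \<ge> 1" using that by (simp add: self_le_power)
    moreover have "0 \<le> G / t" using G(2) \<open>t > 0\<close> by simp
    ultimately show ?thesis using l(1) by (cases "l \<ge> 1") auto
  qed
  obtain C T where C: "countable C" "C \<subseteq> I" "disjoint_family_on (\<lambda>(a, l). ccube a l) C"
    "T \<in> sets lebesgue" "(\<Union>(a, l)\<in>I. ccube a l) \<subseteq> T"
    "emeasure lebesgue T
       \<le> ennreal (vitali_const TYPE('n)) * emeasure lebesgue (\<Union>(a, l)\<in>C. ccube a l)"
    by (rule vitali_cubes[OF bdd])
  have sC: "(\<Union>(a, l)\<in>C. ccube a l) \<in> sets lebesgue"
    using C(1) by (intro sets.countable_UN') auto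
  have "ennreal t * emeasure lebesgue (\<Union>(a, l)\<in>C. ccube a l)
      = ennreal t * (\<integral>\<^sup>+i. emeasure lebesgue (case i of (a, l) \<Rightarrow> ccube a l) \<partial>count_space C)"
    using C(1,3) by (subst emeasure_UN_countable) auto
  also have "\<dots> = (\<integral>\<^sup>+i. ennreal t * emeasure lebesgue (case i of (a, l) \<Rightarrow> ccube a l) \<partial>count_space C)"
    by (simp add: nn_integral_cmult)
  also have "\<dots> \<le> (\<integral>\<^sup>+i. emeasure \<mu> (case i of (a, l) \<Rightarrow> ccube a l) \<partial>count_space C)"
  proof (rule nn_integral_mono)
    fix i assume "i \<in> space (count_space C)"
    then obtain a l where i: "i = (a, l)" "(a, l) \<in> I" using C(2) by (cases i) auto
    then have l: "l > 0" "ennreal t * ennreal (l ^ CARD('n)) < (\<integral>\<^sup>+y\<in>ccube a l. ennreal \<bar>g y\<bar> \<partial>lebesgue)"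
      by (auto simp: I_def)
    then show "ennreal t * emeasure lebesgue (case i of (a, l) \<Rightarrow> ccube a l)
        \<le> emeasure \<mu> (case i of (a, l) \<Rightarrow> ccube a l)"
      by (simp add: i emeasure_lborel_ccube \<mu> less_imp_le)
  qed
  also have "\<dots> = emeasure \<mu> (\<Union>(a, l)\<in>C. ccube a l)"
    using C(1,3) by (subst emeasure_UN_countable) (auto simp: \<mu>_def)
  also have "\<dots> \<le> emeasure \<mu> U"
  proof (rule emeasure_mono)
    show "(\<Union>(a, l)\<in>C. ccube a l) \<subseteq> U" using C(2) UI by blast
  qed (simp add: \<mu>_def U)
  finally have *: "ennreal t * emeasure lebesgue (\<Union>(a, l)\<in>C. ccube a l) \<le> emeasure \<mu> U" .
  have "ennreal t * emeasure lebesgue U \<le> ennreal t * emeasure lebesgue T"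
    using C(4,5) UI by (intro mult_left_mono emeasure_mono) auto
  also have "\<dots> \<le> ennreal t * (ennreal (vitali_const TYPE('n)) * emeasure lebesgue (\<Union>(a, l)\<in>C. ccube a l))"
    by (intro mult_left_mono C(6)) auto
  also have "\<dots> = ennreal (vitali_const TYPE('n)) * (ennreal t * emeasure lebesgue (\<Union>(a, l)\<in>C. ccube a l))"
    by (simp add: mult_ac)
  also have "\<dots> \<le> ennreal (vitali_const TYPE('n)) * emeasure \<mu> U"
    by (intro mult_left_mono *) auto
  finally show ?thesis using \<mu>[OF U] by (simp add: U_def)
qed

text \<open>
  This replaces the theorem of Coifman and Rochberg. Let \<open>R\<close> be the given cube. For \<open>t\<close> above
  \<open>3\<^sup>n M g(x\<^sub>0)\<close>, a cube \<open>S\<close> that meets \<open>R\<close> and has average above \<open>t\<close> must be smaller than \<open>R\<close>,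
  because otherwise the dilate \<open>3S\<close> contains \<open>x\<^sub>0\<close>. Hence \<open>S\<close> only sees the part of \<open>g\<close> in \<open>3R\<close>, and the
  mass of that part is controlled by \<open>M g(x\<^sub>0)\<close>. For smaller \<open>t\<close> the trivial bound by \<open>|R|\<close> is enough.
\<close>

lemma hl_maximal_local_weak_type:
  fixes g :: "real ^ 'n \<Rightarrow> real"
  assumes g [measurable]: "g \<in> borel_measurable lebesgue"
    and fin: "(\<integral>\<^sup>+x. ennreal \<bar>g x\<bar> \<partial>lebesgue) < \<infinity>" and "t > 0" "l > 0" and x0: "x0 \<in> ccube a l"
  shows "ennreal t * emeasure lebesgue {x \<in> ccube a l. ennreal t < hl_maximal g x}
     \<le> ennreal (vitali_const TYPE('n) * 3 ^ CARD('n) * l ^ CARD('n)) * hl_maximal g x0"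
proof (cases "ennreal t \<le> ennreal (3 ^ CARD('n)) * hl_maximal g x0")
  case True
  have "ennreal t * emeasure lebesgue {x \<in> ccube a l. ennreal t < hl_maximal g x}
     \<le> ennreal (3 ^ CARD('n)) * hl_maximal g x0 * emeasure lebesgue (ccube a l)"
    by (intro mult_mono True emeasure_mono) auto
  also have "\<dots> = ennreal (1 * 3 ^ CARD('n) * l ^ CARD('n)) * hl_maximal g x0"
    using \<open>l > 0\<close> by (subst emeasure_ccube) (simp_all add: ennreal_mult mult_ac)
  also have "\<dots> \<le> ennreal (vitali_const TYPE('n) * 3 ^ CARD('n) * l ^ CARD('n)) * hl_maximal g x0"
    using vitali_const_ge_1[where 'n='n] \<open>l > 0\<close>
    by (intro mult_right_mono ennreal_leI) auto
  finally show ?thesis .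
next
  case False
  let ?b = "\<chi> i. a $ i - l"
  define h where "h = (\<lambda>x. g x * indicator (ccube ?b (3 * l)) x)"
  have h [measurable]: "h \<in> borel_measurable lebesgue" unfolding h_def
    by (intro borel_measurable_times g borel_measurable_indicator) auto
  have hint: "(\<integral>\<^sup>+x. ennreal \<bar>h x\<bar> \<partial>lebesgue) = (\<integral>\<^sup>+x\<in>ccube ?b (3 * l). ennreal \<bar>g x\<bar> \<partial>lebesgue)"
    by (intro nn_integral_cong) (auto simp: h_def split: split_indicator)
  also have "\<dots> \<le> ennreal ((3 * l) ^ CARD('n)) * hl_maximal g x0"
  proof (rule average_le_hl_maximal)
    show "x0 \<in> ccube ?b (3 * l)"
      unfolding mem_ccube
    proof
      fix i
      show "?b $ i \<le> x0 $ i \<and> x0 $ i \<le> ?b $ i + 3 * l"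
        using x0[unfolded mem_ccube, rule_format, of i] \<open>l > 0\<close> by simp
    qed
  qed (use \<open>l > 0\<close> in auto)
  finally have hle: "(\<integral>\<^sup>+x. ennreal \<bar>h x\<bar> \<partial>lebesgue) \<le> ennreal ((3 * l) ^ CARD('n)) * hl_maximal g x0" .
  have hfin: "(\<integral>\<^sup>+x. ennreal \<bar>h x\<bar> \<partial>lebesgue) < \<infinity>"
  proof -
    have "(\<integral>\<^sup>+x. ennreal \<bar>h x\<bar> \<partial>lebesgue) \<le> (\<integral>\<^sup>+x. ennreal \<bar>g x\<bar> \<partial>lebesgue)"
      by (intro nn_integral_mono) (auto simp: h_def split: split_indicator)
    then show ?thesis using fin by (rule le_less_trans)
  qed
  have sub: "{x \<in> ccube a l. ennreal t < hl_maximal g x} \<subseteq> {x. ennreal t < hl_maximal h x}"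
  proof clarify
    fix y assume y: "y \<in> ccube a l" "ennreal t < hl_maximal g y"
    then obtain b s where s: "s > 0" "y \<in> ccube b s"
       "ennreal t * ennreal (s ^ CARD('n)) < (\<integral>\<^sup>+y\<in>ccube b s. ennreal \<bar>g y\<bar> \<partial>lebesgue)"
      by (auto simp: less_hl_maximal_iff)
    have "s < l"
    proof (rule ccontr)
      assume "\<not> s < l"
      let ?c = "\<chi> i. b $ i - s"
      have x0': "x0 \<in> ccube ?c (3 * s)"
        unfolding mem_ccube
      proof
        fix i
        show "?c $ i \<le> x0 $ i \<and> x0 $ i \<le> ?c $ i + 3 * s"
          using x0[unfolded mem_ccube, rule_format, of i] y(1)[unfolded mem_ccube, rule_format, of i]
            s(2)[unfolded mem_ccube, rule_format, of i] \<open>\<not> s < l\<close> by simp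
      qed
      have sub': "ccube b s \<subseteq> ccube ?c (3 * s)"
      proof
        fix x assume x: "x \<in> ccube b s"
        show "x \<in> ccube ?c (3 * s)"
          unfolding mem_ccube
        proof
          fix i
          show "?c $ i \<le> x $ i \<and> x $ i \<le> ?c $ i + 3 * s"
            using x[unfolded mem_ccube, rule_format, of i] s(1) by simp
        qed
      qed
      have "(\<integral>\<^sup>+y\<in>ccube b s. ennreal \<bar>g y\<bar> \<partial>lebesgue) \<le> (\<integral>\<^sup>+y\<in>ccube ?c (3 * s). ennreal \<bar>g y\<bar> \<partial>lebesgue)"
        by (rule nn_set_integral_set_mono[OF sub'])
      also have "\<dots> \<le> ennreal ((3 * s) ^ CARD('n)) * hl_maximal g x0"
        using s(1) x0' by (intro average_le_hl_maximal) auto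
      also have "\<dots> = (ennreal (3 ^ CARD('n)) * hl_maximal g x0) * ennreal (s ^ CARD('n))"
        using s(1) by (simp add: power_mult_distrib ennreal_mult mult_ac)
      also have "\<dots> \<le> ennreal t * ennreal (s ^ CARD('n))"
        using False by (intro mult_right_mono) auto
      finally show False using s(3) by simp
    qed
    have sub'': "ccube b s \<subseteq> ccube ?b (3 * l)"
    proof
      fix x assume x: "x \<in> ccube b s"
      show "x \<in> ccube ?b (3 * l)"
        unfolding mem_ccube
      proof
        fix i
        show "?b $ i \<le> x $ i \<and> x $ i \<le> ?b $ i + 3 * l"
          using x[unfolded mem_ccube, rule_format, of i] y(1)[unfolded mem_ccube, rule_format, of i]
            s(2)[unfolded mem_ccube, rule_format, of i] \<open>s < l\<close> by simp
      qed
    qed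
    have "(\<integral>\<^sup>+y\<in>ccube b s. ennreal \<bar>g y\<bar> \<partial>lebesgue) = (\<integral>\<^sup>+y\<in>ccube b s. ennreal \<bar>h y\<bar> \<partial>lebesgue)"
      using sub'' by (intro nn_integral_cong) (auto simp: h_def split: split_indicator)
    then show "ennreal t < hl_maximal h y"
      unfolding less_hl_maximal_iff using s by (intro exI[of _ b] exI[of _ s]) simp
  qed
  have "ennreal t * emeasure lebesgue {x \<in> ccube a l. ennreal t < hl_maximal g x}
     \<le> ennreal t * emeasure lebesgue {x. ennreal t < hl_maximal h x}"
    by (intro mult_left_mono emeasure_mono sub sets_hl_maximal_greater) auto
  also have "\<dots> \<le> ennreal (vitali_const TYPE('n)) *
        (\<integral>\<^sup>+x\<in>{x. ennreal t < hl_maximal h x}. ennreal \<bar>h x\<bar> \<partial>lebesgue)"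
    by (rule hl_maximal_weak_type[OF h hfin \<open>t > 0\<close>])
  also have "\<dots> \<le> ennreal (vitali_const TYPE('n)) * (\<integral>\<^sup>+x. ennreal \<bar>h x\<bar> \<partial>lebesgue)"
    by (intro mult_left_mono nn_integral_mono) (auto split: split_indicator)
  also have "\<dots> \<le> ennreal (vitali_const TYPE('n)) * (ennreal ((3 * l) ^ CARD('n)) * hl_maximal g x0)"
    by (intro mult_left_mono hle) auto
  also have "\<dots> = ennreal (vitali_const TYPE('n) * 3 ^ CARD('n) * l ^ CARD('n)) * hl_maximal g x0"
    using vitali_const_ge_1[where 'n='n] \<open>l > 0\<close> by (simp add: power_mult_distrib ennreal_mult mult_ac)
  finally show ?thesis .
qed

section \<open>Counting dyadic levels of the maximal function\<close>

lemma suminf_ennreal_le: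
  fixes f :: "nat \<Rightarrow> ennreal"
  assumes "\<And>m. sum f {..<m} \<le> B"
  shows "suminf f \<le> B"
  unfolding suminf_eq_SUP using assms by (intro SUP_least) auto

lemma suminf_half_power: "(\<Sum>k. ennreal ((1 / 2) ^ k)) = 2"
proof -
  have "(\<Sum>k. ennreal ((1 / 2) ^ k)) = ennreal (\<Sum>k. (1 / 2) ^ k)"
    by (intro suminf_ennreal2) (auto intro: summable_geometric)
  also have "(\<Sum>k. (1 / 2 :: real) ^ k) = 2"
    by (subst suminf_geometric) auto
  finally show ?thesis by simp
qed

text \<open>
  The sum is a geometric series that starts at its first term not exceeding one. With
  \<open>u k = min 1 (\<alpha> / (2\<^sup>k a))\<close> every term is at most \<open>2 (u k - u (k+1))\<close>, so the partial sums telescope.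
\<close>

lemma suminf_tail_half_powers_le:
  fixes \<alpha> a :: real
  assumes "\<alpha> \<ge> 0" "a > 0"
  shows "(\<Sum>k. ennreal (if \<alpha> \<le> 2 ^ k * a then \<alpha> / (2 ^ k * a) else 0)) \<le> 2"
proof (rule suminf_ennreal_le)
  fix m :: nat
  define u where "u = (\<lambda>k. min 1 (\<alpha> / (2 ^ k * a)))"
  have u0: "u k \<ge> 0" "u k \<le> 1" for k using assms by (auto simp: u_def)
  have step: "(if \<alpha> \<le> 2 ^ k * a then \<alpha> / (2 ^ k * a) else 0) \<le> 2 * (u k - u (Suc k))" for k
  proof (cases "\<alpha> \<le> 2 ^ k * a")
    case True
    have "u k = \<alpha> / (2 ^ k * a)" using True assms by (simp add: u_def min_def field_simps)
    moreover have "u (Suc k) \<le> \<alpha> / (2 ^ k * a) / 2"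
      unfolding u_def by (rule min.coboundedI2) (simp add: field_simps)
    ultimately show ?thesis using True by simp
  next
    case False
    then have "u k = 1" using assms by (simp add: u_def min_def field_simps)
    then show ?thesis using False u0(2)[of "Suc k"] by simp
  qed
  have "(\<Sum>k<m. ennreal (if \<alpha> \<le> 2 ^ k * a then \<alpha> / (2 ^ k * a) else 0))
      = ennreal (\<Sum>k<m. (if \<alpha> \<le> 2 ^ k * a then \<alpha> / (2 ^ k * a) else 0))"
    using assms by (intro sum_ennreal) auto
  also have "\<dots> \<le> ennreal (\<Sum>k<m. 2 * (u k - u (Suc k)))"
    by (intro ennreal_leI sum_mono step)
  also have "(\<Sum>k<m. 2 * (u k - u (Suc k))) = 2 * (u 0 - u m)"
    unfolding sum_distrib_left[symmetric] by (simp add: sum_lessThan_telescope')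
  also have "ennreal \<dots> \<le> ennreal 2" using u0[of 0] u0[of m] by (intro ennreal_leI) auto
  finally show "(\<Sum>k<m. ennreal (if \<alpha> \<le> 2 ^ k * a then \<alpha> / (2 ^ k * a) else 0)) \<le> 2" by simp
qed

lemma ennreal_le_mult_inverseI:
  assumes "t > 0" "ennreal t * m \<le> b"
  shows "m \<le> ennreal (1 / t) * b"
proof -
  have "m = ennreal (1 / t) * (ennreal t * m)"
    using assms(1) by (simp add: mult.assoc[symmetric] ennreal_mult[symmetric])
  also have "\<dots> \<le> ennreal (1 / t) * b" by (intro mult_left_mono assms(2)) auto
  finally show ?thesis .
qed

text \<open>
  Up to an additive constant this is the positive part of \<open>log\<^sub>2 (M g / a)\<close>. It takes the value
  \<open>\<infinity>\<close> where the maximal function does.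
\<close>

definition level_count :: "real \<Rightarrow> (real ^ 'n \<Rightarrow> real) \<Rightarrow> real ^ 'n \<Rightarrow> ennreal" where
  "level_count a g x = (\<Sum>k. indicator {y. ennreal (2 ^ k * a) < hl_maximal g y} x)"

lemma borel_measurable_level_count [measurable]: "level_count a g \<in> borel_measurable lebesgue"
proof -
  have [measurable]: "{y. ennreal (2 ^ k * a) < hl_maximal g y} \<in> sets lebesgue" for k
    by (rule sets_hl_maximal_greater)
  show ?thesis unfolding level_count_def[abs_def] by measurable
qed

lemma nn_integral_level_count_le:
  fixes g :: "real ^ 'n \<Rightarrow> real"
  assumes g [measurable]: "g \<in> borel_measurable lebesgue"
    and fin: "(\<integral>\<^sup>+x. ennreal \<bar>g x\<bar> \<partial>lebesgue) < \<infinity>" and "a > 0"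
  shows "(\<integral>\<^sup>+x. level_count a g x \<partial>lebesgue)
     \<le> ennreal (2 * vitali_const TYPE('n) / a) * (\<integral>\<^sup>+x. ennreal \<bar>g x\<bar> \<partial>lebesgue)"
proof -
  let ?K = "vitali_const TYPE('n)" and ?G = "\<integral>\<^sup>+x. ennreal \<bar>g x\<bar> \<partial>lebesgue"
  have K: "?K \<ge> 1" by (rule vitali_const_ge_1)
  have "(\<integral>\<^sup>+x. level_count a g x \<partial>lebesgue)
      = (\<Sum>k. emeasure lebesgue {y. ennreal (2 ^ k * a) < hl_maximal g y})"
    unfolding level_count_def
    by (subst nn_integral_suminf) (auto simp: sets_hl_maximal_greater)
  also have "\<dots> \<le> (\<Sum>k. ennreal ((1 / 2) ^ k) * (ennreal (?K / a) * ?G))"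
  proof (intro suminf_le allI)
    fix k
    have "ennreal (2 ^ k * a) * emeasure lebesgue {y. ennreal (2 ^ k * a) < hl_maximal g y}
       \<le> ennreal ?K * (\<integral>\<^sup>+x\<in>{x. ennreal (2 ^ k * a) < hl_maximal g x}. ennreal \<bar>g x\<bar> \<partial>lebesgue)"
      using \<open>a > 0\<close> by (intro hl_maximal_weak_type g fin) auto
    also have "\<dots> \<le> ennreal ?K * ?G"
      by (intro mult_left_mono nn_integral_mono) (auto split: split_indicator)
    finally have "emeasure lebesgue {y. ennreal (2 ^ k * a) < hl_maximal g y}
        \<le> ennreal (1 / (2 ^ k * a)) * (ennreal ?K * ?G)"
      using \<open>a > 0\<close> by (intro ennreal_le_mult_inverseI) auto
    also have "\<dots> = ennreal ((1 / 2) ^ k) * (ennreal (?K / a) * ?G)"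
      using \<open>a > 0\<close> K
      by (simp add: mult.assoc[symmetric] ennreal_mult[symmetric] power_divide field_simps)
    finally show "emeasure lebesgue {y. ennreal (2 ^ k * a) < hl_maximal g y}
        \<le> ennreal ((1 / 2) ^ k) * (ennreal (?K / a) * ?G)" .
  qed auto
  also have "\<dots> = 2 * (ennreal (?K / a) * ?G)"
    by (simp add: suminf_half_power)
  also have "\<dots> = ennreal (2 * ?K / a) * ?G"
    using \<open>a > 0\<close> K
    by (subst mult.assoc[symmetric], subst ennreal_numeral[symmetric], subst ennreal_mult[symmetric]) auto
  finally show ?thesis .
qed

lemma AE_level_count_finite:
  fixes g :: "real ^ 'n \<Rightarrow> real"
  assumes "g \<in> borel_measurable lebesgue"
    and "(\<integral>\<^sup>+x. ennreal \<bar>g x\<bar> \<partial>lebesgue) < \<infinity>" and "a > 0"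
  shows "AE x in lebesgue. level_count a g x < \<infinity>"
proof -
  have "(\<integral>\<^sup>+x. level_count a g x \<partial>lebesgue) < \<infinity>"
    using nn_integral_level_count_le[OF assms] assms(2)
    by (auto intro: le_less_trans simp: ennreal_mult_less_top)
  then show ?thesis
    using nn_integral_PInf_AE[OF borel_measurable_level_count, of a g] by (auto simp: top.not_eq_extremum)
qed

lemma hl_maximal_finite_if_level_count:
  assumes "level_count a g x < \<infinity>"
  shows "hl_maximal g x < \<infinity>"
proof (rule ccontr)
  assume "\<not> hl_maximal g x < \<infinity>"
  then have "level_count a g x = (\<Sum>k. 1 :: ennreal)"
    unfolding level_count_def by (intro suminf_cong) (auto simp: less_top[symmetric])
  also have "\<dots> = \<infinity>"
    by (simp add: suminf_eq_SUP ennreal_SUP_of_nat_eq_top)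
  finally show False using assms by simp
qed

text \<open>
  The constant is the count at the infimum \<open>A\<close> of \<open>M g\<close> over the cube \<open>R\<close>. Subtracting it leaves only
  levels \<open>t \<ge> A\<close>. The local weak type inequality, taken at all points of \<open>R\<close>, bounds
  the measure of \<open>{y \<in> R. M g(y) > t}\<close> by a multiple of \<open>|R| A / t\<close>, and these bounds form a
  geometric series.
\<close>

lemma level_count_oscillation:
  fixes g :: "real ^ 'n \<Rightarrow> real"
  assumes g [measurable]: "g \<in> borel_measurable lebesgue"
    and fin: "(\<integral>\<^sup>+x. ennreal \<bar>g x\<bar> \<partial>lebesgue) < \<infinity>" and "a > 0" "l > 0"
  shows "\<exists>c. (\<integral>\<^sup>+x\<in>ccube b l. ennreal \<bar>enn2real (level_count a g x) - c\<bar> \<partial>lebesgue)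
     \<le> ennreal (2 * (vitali_const TYPE('n) * 3 ^ CARD('n)) * l ^ CARD('n))"
proof -
  let ?K = "vitali_const TYPE('n) * 3 ^ CARD('n)"
  have K: "?K \<ge> 1"
    using mult_mono[OF vitali_const_ge_1[where 'n='n] one_le_power[of "3 :: real" "CARD('n)"]] vitali_const_ge_1[where 'n='n]
    by simp
  let ?F = "hl_maximal g"
  define A where "A = (INF x\<in>ccube b l. ?F x)"
  define S where "S = (\<lambda>k :: nat. {y. ennreal (2 ^ k * a) < ?F y})"
  have S [measurable]: "S k \<in> sets lebesgue" for k
    unfolding S_def by (rule sets_hl_maximal_greater)
  have R [measurable]: "ccube b l \<in> sets lebesgue" by simp
  have ae: "AE x in lebesgue. level_count a g x < \<infinity>" by (rule AE_level_count_finite[OF assms(1-3)])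
  \<comment> \<open>Almost every point has a finite count; one such point in the cube shows that the infimum is finite.\<close>
  obtain y0 where y0: "y0 \<in> ccube b l" "level_count a g y0 < \<infinity>"
  proof -
    have "\<exists>y\<in>ccube b l. level_count a g y < \<infinity>"
    proof (rule ccontr)
      assume "\<not> ?thesis"
      with ae have "AE x in lebesgue. x \<notin> ccube b l" by (auto elim!: eventually_mono)
      then have "emeasure lebesgue (ccube b l) = 0"
        by (subst (asm) AE_iff_measurable[OF R]) auto
      then show False using \<open>l > 0\<close> by (simp add: emeasure_lborel_ccube)
    qed
    then show thesis using that by blast
  qed
  have "A \<le> ?F y0" unfolding A_def using y0(1) by (rule INF_lower)
  also have "\<dots> < \<infinity>" by (rule hl_maximal_finite_if_level_count[OF y0(2)])
  finally obtain \<alpha> where \<alpha>: "A = ennreal \<alpha>" "\<alpha> \<ge> 0" by (cases A) auto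
  have AF: "A \<le> ?F y" if "y \<in> ccube b l" for y
    unfolding A_def using that by (rule INF_lower)
  define c' where "c' = (\<Sum>k. if 2 ^ k * a < \<alpha> then 1 else 0 :: ennreal)"
  define D where "D = (\<lambda>y. \<Sum>k. (if \<alpha> \<le> 2 ^ k * a then indicator (S k) y else 0 :: ennreal))"
  have split: "level_count a g y = c' + D y" if "y \<in> ccube b l" for y
  proof -
    have "c' + D y = (\<Sum>k. (if 2 ^ k * a < \<alpha> then 1 else 0) + (if \<alpha> \<le> 2 ^ k * a then indicator (S k) y else 0 :: ennreal))"
      unfolding c'_def D_def by (intro suminf_add) auto
    also have "\<dots> = level_count a g y"
      unfolding level_count_def
    proof (rule suminf_cong)
      fix k
      show "(if 2 ^ k * a < \<alpha> then 1 else 0) + (if \<alpha> \<le> 2 ^ k * a then indicator (S k) y else 0)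
          = (indicator {y. ennreal (2 ^ k * a) < ?F y} y :: ennreal)"
      proof (cases "2 ^ k * a < \<alpha>")
        case True
        then have "ennreal (2 ^ k * a) < A" using \<alpha> \<open>a > 0\<close> by (simp add: ennreal_less_iff)
        then have "ennreal (2 ^ k * a) < ?F y" using AF[OF that] by (rule less_le_trans)
        then show ?thesis using True by simp
      next
        case False
        then show ?thesis by (simp add: S_def)
      qed
    qed
    finally show ?thesis by simp
  qed
  have "(\<integral>\<^sup>+x\<in>ccube b l. ennreal \<bar>enn2real (level_count a g x) - enn2real c'\<bar> \<partial>lebesgue)
     = (\<integral>\<^sup>+x\<in>ccube b l. D x \<partial>lebesgue)"
  proof (rule nn_integral_cong_AE, use ae in \<open>rule eventually_mono\<close>)
    fix x assume fx: "level_count a g x < \<infinity>"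
    show "ennreal \<bar>enn2real (level_count a g x) - enn2real c'\<bar> * indicator (ccube b l) x = D x * indicator (ccube b l) x"
    proof (cases "x \<in> ccube b l")
      case True
      have "c' < \<infinity>" "D x < \<infinity>" using fx split[OF True] by auto
      then have "ennreal \<bar>enn2real (level_count a g x) - enn2real c'\<bar> = D x"
        by (cases c'; cases "D x") (auto simp: split[OF True] enn2real_plus)
      then show ?thesis by simp
    qed simp
  qed
  also have "\<dots> = (\<integral>\<^sup>+x. (\<Sum>k. (if \<alpha> \<le> 2 ^ k * a then indicator (S k \<inter> ccube b l) x else 0 :: ennreal)) \<partial>lebesgue)"
    unfolding D_def ennreal_suminf_multc[symmetric]
    by (intro nn_integral_cong suminf_cong) (auto split: split_indicator)
  also have "\<dots> = (\<Sum>k. \<integral>\<^sup>+x. (if \<alpha> \<le> 2 ^ k * a then indicator (S k \<inter> ccube b l) x else 0 :: ennreal) \<partial>lebesgue)"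
    by (intro nn_integral_suminf) auto
  also have "\<dots> \<le> (\<Sum>k. ennreal (?K * l ^ CARD('n)) * ennreal (if \<alpha> \<le> 2 ^ k * a then \<alpha> / (2 ^ k * a) else 0))"
  proof (intro suminf_le allI)
    fix k
    show "(\<integral>\<^sup>+x. (if \<alpha> \<le> 2 ^ k * a then indicator (S k \<inter> ccube b l) x else 0 :: ennreal) \<partial>lebesgue)
        \<le> ennreal (?K * l ^ CARD('n)) * ennreal (if \<alpha> \<le> 2 ^ k * a then \<alpha> / (2 ^ k * a) else 0)"
    proof (cases "\<alpha> \<le> 2 ^ k * a")
      case True
      have eq: "S k \<inter> ccube b l = {x \<in> ccube b l. ennreal (2 ^ k * a) < ?F x}"
        by (auto simp: S_def)
      have pos: "ennreal (?K * l ^ CARD('n)) > 0" proof -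
        have "0 < ?K * l ^ CARD('n)" using vitali_const_ge_1[where 'n='n] \<open>l > 0\<close> by simp
        then show ?thesis by simp
      qed
      have "ennreal (2 ^ k * a) * emeasure lebesgue (S k \<inter> ccube b l) / ennreal (?K * l ^ CARD('n)) \<le> A"
        unfolding A_def
      proof (rule INF_greatest)
        fix x assume "x \<in> ccube b l"
        then show "ennreal (2 ^ k * a) * emeasure lebesgue (S k \<inter> ccube b l) / ennreal (?K * l ^ CARD('n)) \<le> ?F x"
          unfolding eq using \<open>a > 0\<close> \<open>l > 0\<close>
          by (intro divide_le_posI_ennreal[OF pos] hl_maximal_local_weak_type g fin) auto
      qed
      then have "ennreal (2 ^ k * a) * emeasure lebesgue (S k \<inter> ccube b l) \<le> A * ennreal (?K * l ^ CARD('n))"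
        using less_divide_ennreal[of "?K * l ^ CARD('n)"] pos
        by (simp add: not_less[symmetric])
      then have "emeasure lebesgue (S k \<inter> ccube b l) \<le> ennreal (1 / (2 ^ k * a)) * (A * ennreal (?K * l ^ CARD('n)))"
        using \<open>a > 0\<close> by (intro ennreal_le_mult_inverseI) auto
      also have "\<dots> = ennreal (?K * l ^ CARD('n)) * ennreal (\<alpha> / (2 ^ k * a))"
      proof -
        have eq1: "ennreal (1 / (2 ^ k * a)) * A = ennreal (\<alpha> / (2 ^ k * a))"
          unfolding \<alpha>(1) using \<alpha>(2) \<open>a > 0\<close> by (subst ennreal_mult[symmetric]) auto
        show ?thesis unfolding mult.assoc[symmetric, of "ennreal (1 / (2 ^ k * a))" A] eq1 by (rule mult.commute)
      qed
      finally show ?thesis using True by simp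
    qed simp
  qed auto
  also have "\<dots> = ennreal (?K * l ^ CARD('n)) * (\<Sum>k. ennreal (if \<alpha> \<le> 2 ^ k * a then \<alpha> / (2 ^ k * a) else 0))"
    by simp
  also have "\<dots> \<le> ennreal (?K * l ^ CARD('n)) * 2"
    by (intro mult_left_mono suminf_tail_half_powers_le \<alpha> \<open>a > 0\<close>) auto
  also have "\<dots> = ennreal (2 * ?K * l ^ CARD('n))"
    using vitali_const_ge_1[where 'n='n] \<open>l > 0\<close>
    by (subst ennreal_numeral[symmetric], subst ennreal_mult[symmetric]) (auto simp: mult_ac)
  finally show ?thesis by blast
qed

text \<open>
  Wiener's \<open>L log L\<close> bound in discrete form. The function \<open>M g\<close> is at most \<open>a\<close> plus the sum of
  \<open>2 (2\<^sup>k a)\<close> over the levels \<open>2\<^sup>k a\<close> below it, and the weak type inequality turns each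
  level into the integral of \<open>|g|\<close> over the corresponding level set. Summing these integrals counts levels.
\<close>

lemma nn_integral_hl_maximal_le:
  fixes g :: "real ^ 'n \<Rightarrow> real"
  assumes g [measurable]: "g \<in> borel_measurable lebesgue"
    and fin: "(\<integral>\<^sup>+x. ennreal \<bar>g x\<bar> \<partial>lebesgue) < \<infinity>" and "a > 0"
    and Q [measurable]: "Q \<in> sets lebesgue"
  shows "(\<integral>\<^sup>+x\<in>Q. hl_maximal g x \<partial>lebesgue)
     \<le> ennreal a * emeasure lebesgue Q
        + ennreal (2 * vitali_const TYPE('n)) * (\<integral>\<^sup>+x. level_count a g x * ennreal \<bar>g x\<bar> \<partial>lebesgue)"
proof -
  let ?K = "vitali_const TYPE('n)"
  let ?F = "hl_maximal g"
  define S where "S = (\<lambda>k :: nat. {y. ennreal (2 ^ k * a) < ?F y})"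
  have S [measurable]: "S k \<in> sets lebesgue" for k
    unfolding S_def by (rule sets_hl_maximal_greater)
  have pw: "?F x \<le> ennreal a + (\<Sum>k. 2 * ennreal (2 ^ k * a) * indicator (S k) x)" if "?F x < \<infinity>" for x
  proof -
    obtain r where r: "?F x = ennreal r" "r \<ge> 0" using \<open>?F x < \<infinity>\<close> by (cases "?F x") auto
    obtain m where "r / a < 2 ^ m" using real_arch_pow[of 2 "r / a"] by auto
    then have ex: "r \<le> 2 ^ m * a" using \<open>a > 0\<close> by (simp add: field_simps)
    \<comment> \<open>For \<open>m0 = k + 1\<close> the single term of index \<open>k\<close> already dominates the value.\<close>
    define m0 where "m0 = (LEAST m. r \<le> 2 ^ m * a)"
    have m0: "r \<le> 2 ^ m0 * a" unfolding m0_def by (rule LeastI[of "\<lambda>m. r \<le> 2 ^ m * a", OF ex])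
    show ?thesis
    proof (cases m0)
      case 0
      then have "?F x \<le> ennreal a" using m0 r by (simp add: ennreal_leI)
      then show ?thesis by (rule add_increasing2[rotated]) simp
    next
      case (Suc k)
      have "\<not> r \<le> 2 ^ k * a" using not_less_Least[of k "\<lambda>m. r \<le> 2 ^ m * a"] Suc by (simp add: m0_def)
      then have "x \<in> S k" using r \<open>a > 0\<close> by (simp add: S_def ennreal_less_iff)
      have "?F x \<le> ennreal (2 * (2 ^ k * a))" using m0 Suc r by (simp add: ennreal_leI mult.assoc)
      also have "\<dots> = 2 * ennreal (2 ^ k * a) * indicator (S k) x"
        using \<open>x \<in> S k\<close> \<open>a > 0\<close> by (simp add: ennreal_mult)
      also have "\<dots> = (\<Sum>j\<in>{k}. 2 * ennreal (2 ^ j * a) * indicator (S j) x)"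
        by (simp only: sum.insert finite.emptyI empty_iff not_False_eq_True sum.empty add_0_right)
      also have "\<dots> \<le> (\<Sum>k. 2 * ennreal (2 ^ k * a) * indicator (S k) x)"
        by (rule sum_le_suminf) auto
      finally show ?thesis by (rule add_increasing[rotated]) simp
    qed
  qed
  have "(\<integral>\<^sup>+x\<in>Q. ?F x \<partial>lebesgue)
      \<le> (\<integral>\<^sup>+x. ennreal a * indicator Q x + (\<Sum>k. 2 * ennreal (2 ^ k * a) * indicator (S k) x) \<partial>lebesgue)"
  proof (rule nn_integral_mono_AE, use AE_level_count_finite[OF assms(1-3)] in \<open>rule eventually_mono\<close>)
    fix x assume "level_count a g x < \<infinity>"
    then have "?F x < \<infinity>" by (rule hl_maximal_finite_if_level_count)
    then show "?F x * indicator Q x \<le> ennreal a * indicator Q x + (\<Sum>k. 2 * ennreal (2 ^ k * a) * indicator (S k) x)"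
      using pw by (auto split: split_indicator)
  qed
  also have "\<dots> = ennreal a * emeasure lebesgue Q + (\<integral>\<^sup>+x. (\<Sum>k. 2 * ennreal (2 ^ k * a) * indicator (S k) x) \<partial>lebesgue)"
    by (subst nn_integral_add) (auto simp: nn_integral_cmult_indicator)
  also have "(\<integral>\<^sup>+x. (\<Sum>k. 2 * ennreal (2 ^ k * a) * indicator (S k) x) \<partial>lebesgue)
      = (\<Sum>k. 2 * ennreal (2 ^ k * a) * emeasure lebesgue (S k))"
    by (subst nn_integral_suminf) (auto simp: nn_integral_cmult_indicator)
  also have "\<dots> \<le> (\<Sum>k. 2 * (ennreal ?K * (\<integral>\<^sup>+x\<in>S k. ennreal \<bar>g x\<bar> \<partial>lebesgue)))"
    unfolding S_def mult.assoc
    by (intro suminf_le allI mult_left_mono hl_maximal_weak_type g fin) (use \<open>a > 0\<close> in auto)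
  also have "\<dots> = 2 * ennreal ?K * (\<Sum>k. \<integral>\<^sup>+x\<in>S k. ennreal \<bar>g x\<bar> \<partial>lebesgue)"
    by (simp add: mult.assoc)
  also have "(\<Sum>k. \<integral>\<^sup>+x\<in>S k. ennreal \<bar>g x\<bar> \<partial>lebesgue) = (\<integral>\<^sup>+x. (\<Sum>k. ennreal \<bar>g x\<bar> * indicator (S k) x) \<partial>lebesgue)"
    by (intro nn_integral_suminf[symmetric]) auto
  also have "\<dots> = (\<integral>\<^sup>+x. level_count a g x * ennreal \<bar>g x\<bar> \<partial>lebesgue)"
    unfolding level_count_def S_def by (simp add: mult.commute)
  also have "2 * ennreal ?K = ennreal (2 * ?K)"
    using vitali_const_ge_1[where 'n='n] by (simp add: ennreal_mult)
  finally show ?thesis by (simp add: add_left_mono)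
qed

section \<open>Mean oscillation\<close>

lemma content_ccube: "0 \<le> l \<Longrightarrow> measure lborel (ccube a l :: (real ^ 'n) set) = l ^ CARD('n)"
  using measure_ccube[of l a] by simp

lemma cubeE:
  fixes Q :: "(real ^ 'n) set"
  assumes "cube Q"
  obtains a l where "l > 0" "Q = ccube a l"
  using assms unfolding cube_def by blast

lemma set_integrable_ccube: "locally_integrable f \<Longrightarrow> set_integrable lebesgue (ccube a l) f"
  unfolding locally_integrable_def by (metis compact_cbox)

lemma set_integrable_measurable:
  fixes f :: "real ^ 'n \<Rightarrow> real"
  assumes "set_integrable lebesgue S f"
  shows "(\<lambda>x. f x * indicator S x) \<in> borel_measurable lebesgue"
  using assms unfolding set_integrable_def
  by (auto dest!: borel_measurable_integrable simp: mult.commute)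

lemma borel_measurable_abs_diff_indicator:
  fixes f :: "real ^ 'n \<Rightarrow> real"
  assumes "set_integrable lebesgue S f" "S \<in> sets lebesgue"
  shows "(\<lambda>x. ennreal \<bar>f x - c\<bar> * indicator S x) \<in> borel_measurable lebesgue"
proof -
  note [measurable] = set_integrable_measurable[OF assms(1)] assms(2)
  have "(\<lambda>x. ennreal \<bar>f x - c\<bar> * indicator S x) = (\<lambda>x. ennreal \<bar>f x * indicator S x - c\<bar> * indicator S x)"
    by (auto split: split_indicator)
  then show ?thesis by simp
qed

lemma borel_measurable_weighted_oscillation:
  fixes f w :: "real ^ 'n \<Rightarrow> real"
  assumes f: "set_integrable lebesgue S f" and w: "set_integrable lebesgue S w" and S: "S \<in> sets lebesgue"
  shows "(\<lambda>x. ennreal (\<bar>f x - c\<bar> * w x) * indicator S x) \<in> borel_measurable lebesgue"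
proof -
  note [measurable] = set_integrable_measurable[OF f] set_integrable_measurable[OF w] S
  have "(\<lambda>x. ennreal (\<bar>f x - c\<bar> * w x) * indicator S x)
      = (\<lambda>x. ennreal (\<bar>f x * indicator S x - c\<bar> * (w x * indicator S x)) * indicator S x)"
    by (auto split: split_indicator)
  then show ?thesis by simp
qed

lemma average_minus_const_le:
  fixes f :: "real ^ 'n \<Rightarrow> real"
  assumes f: "set_integrable lebesgue S f" and S: "S \<in> lmeasurable" "measure lebesgue S > 0"
  shows "ennreal \<bar>average f S - c\<bar> * emeasure lebesgue S \<le> (\<integral>\<^sup>+x\<in>S. ennreal \<bar>f x - c\<bar> \<partial>lebesgue)"
proof -
  have c: "set_integrable lebesgue S (\<lambda>_. c)"
    using S(1) unfolding set_integrable_def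
    by (intro integrable_scaleR_left integrable_real_indicator) (auto simp: fmeasurable_def)
  have d: "set_integrable lebesgue S (\<lambda>x. f x - c)" by (rule set_integral_diff(1)[OF f c])
  have "(LINT x:S|lebesgue. f x - c) = (LINT x:S|lebesgue. f x) - c * measure lebesgue S"
    using set_integral_diff(2)[OF f c] S(1) by (simp add: set_lebesgue_integral_def mult.commute)
  then have "\<bar>average f S - c\<bar> * measure lebesgue S = \<bar>LINT x:S|lebesgue. f x - c\<bar>"
    using S(2) by (simp add: average_def abs_div_pos[symmetric] field_simps flip: abs_mult_pos)
  then have "ennreal \<bar>average f S - c\<bar> * emeasure lebesgue S = ennreal \<bar>LINT x:S|lebesgue. f x - c\<bar>"
    using S by (simp add: emeasure_eq_measure2 ennreal_mult[symmetric])
  also have "\<dots> \<le> (\<integral>\<^sup>+x. ennreal (norm (indicat_real S x *\<^sub>R (f x - c))) \<partial>lebesgue)"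
    using integral_norm_bound_ennreal[OF d[unfolded set_integrable_def]]
    by (simp add: set_lebesgue_integral_def)
  also have "\<dots> = (\<integral>\<^sup>+x\<in>S. ennreal \<bar>f x - c\<bar> \<partial>lebesgue)"
    by (intro nn_integral_cong) (auto split: split_indicator)
  finally show ?thesis .
qed

lemma oscillation_le_twice:
  fixes f :: "real ^ 'n \<Rightarrow> real"
  assumes f: "set_integrable lebesgue S f" and S: "S \<in> lmeasurable" "measure lebesgue S > 0"
  shows "(\<integral>\<^sup>+x\<in>S. ennreal \<bar>f x - average f S\<bar> \<partial>lebesgue) \<le> 2 * (\<integral>\<^sup>+x\<in>S. ennreal \<bar>f x - c\<bar> \<partial>lebesgue)"
proof -
  have [measurable]: "S \<in> sets lebesgue" using S by auto
  note [measurable] = borel_measurable_abs_diff_indicator[OF f \<open>S \<in> sets lebesgue\<close>]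
  have "(\<integral>\<^sup>+x\<in>S. ennreal \<bar>f x - average f S\<bar> \<partial>lebesgue)
      \<le> (\<integral>\<^sup>+x. ennreal \<bar>f x - c\<bar> * indicator S x + ennreal \<bar>average f S - c\<bar> * indicator S x \<partial>lebesgue)"
    by (intro nn_integral_mono) (auto split: split_indicator simp flip: ennreal_plus intro!: ennreal_leI)
  also have "\<dots> = (\<integral>\<^sup>+x\<in>S. ennreal \<bar>f x - c\<bar> \<partial>lebesgue) + ennreal \<bar>average f S - c\<bar> * emeasure lebesgue S"
    by (subst nn_integral_add) (auto simp: nn_integral_cmult_indicator)
  also have "\<dots> \<le> (\<integral>\<^sup>+x\<in>S. ennreal \<bar>f x - c\<bar> \<partial>lebesgue) + (\<integral>\<^sup>+x\<in>S. ennreal \<bar>f x - c\<bar> \<partial>lebesgue)"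
    by (intro add_left_mono average_minus_const_le f S)
  finally show ?thesis by (simp add: mult_2)
qed

lemma measure_ccube_pos: "l > 0 \<Longrightarrow> measure lebesgue (ccube a l :: (real ^ 'n) set) > 0"
  using measure_ccube[of l a] by simp

lemma bmo_norm_le:
  fixes f :: "real ^ 'n \<Rightarrow> real"
  assumes f: "locally_integrable f" and "B \<ge> 0"
    and osc: "\<And>b l. l > 0 \<Longrightarrow> \<exists>c. (\<integral>\<^sup>+x\<in>ccube b l. ennreal \<bar>f x - c\<bar> \<partial>lebesgue) \<le> ennreal (B * l ^ CARD('n))"
  shows "bmo_norm f \<le> ennreal (2 * B)"
  unfolding bmo_norm_def
proof (rule SUP_least)
  fix R :: "(real ^ 'n) set" assume "R \<in> {Q. cube Q}"
  then obtain b l where R: "l > 0" "R = ccube b l" by (auto elim: cubeE)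
  obtain c where c: "(\<integral>\<^sup>+x\<in>ccube b l. ennreal \<bar>f x - c\<bar> \<partial>lebesgue) \<le> ennreal (B * l ^ CARD('n))"
    using osc[OF R(1)] by blast
  have "(\<integral>\<^sup>+x\<in>R. ennreal \<bar>f x - average f R\<bar> \<partial>lebesgue) \<le> 2 * (\<integral>\<^sup>+x\<in>R. ennreal \<bar>f x - c\<bar> \<partial>lebesgue)"
    unfolding R(2) using R(1)
    by (intro oscillation_le_twice set_integrable_ccube f measure_ccube_pos) auto
  also have "\<dots> \<le> 2 * ennreal (B * l ^ CARD('n))"
    unfolding R(2) by (intro mult_left_mono c) auto
  also have "\<dots> = emeasure lebesgue R * ennreal (2 * B)"
    using R \<open>B \<ge> 0\<close> by (simp add: emeasure_lborel_ccube ennreal_mult mult_ac)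
  finally show "(\<integral>\<^sup>+x\<in>R. ennreal \<bar>f x - average f R\<bar> \<partial>lebesgue) / emeasure lebesgue R \<le> ennreal (2 * B)"
    using R by (intro divide_le_posI_ennreal) (auto simp: emeasure_lborel_ccube)
qed

lemma average_cmult: "average (\<lambda>x. c * f x) Q = c * average f Q"
  by (simp add: average_def)

lemma bmo_norm_cmult:
  fixes f :: "real ^ 'n \<Rightarrow> real"
  assumes f: "locally_integrable f"
  shows "bmo_norm (\<lambda>x. c * f x) = ennreal \<bar>c\<bar> * bmo_norm f"
  unfolding bmo_norm_def SUP_mult_left_ennreal
proof (intro SUP_cong refl)
  fix R :: "(real ^ 'n) set" assume "R \<in> {Q. cube Q}"
  then obtain b l where R: "l > 0" "R = ccube b l" by (auto elim: cubeE)
  have m: "(\<lambda>x. ennreal \<bar>f x - average f R\<bar> * indicator R x) \<in> borel_measurable lebesgue"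
    unfolding R(2) by (intro borel_measurable_abs_diff_indicator set_integrable_ccube f) auto
  have "(\<integral>\<^sup>+x\<in>R. ennreal \<bar>c * f x - average (\<lambda>x. c * f x) R\<bar> \<partial>lebesgue)
      = (\<integral>\<^sup>+x. ennreal \<bar>c\<bar> * (ennreal \<bar>f x - average f R\<bar> * indicator R x) \<partial>lebesgue)"
    unfolding average_cmult right_diff_distrib[symmetric] abs_mult
    by (simp add: ennreal_mult mult.assoc)
  also have "\<dots> = ennreal \<bar>c\<bar> * (\<integral>\<^sup>+x\<in>R. ennreal \<bar>f x - average f R\<bar> \<partial>lebesgue)"
    by (rule nn_integral_cmult[OF m])
  finally show "(\<integral>\<^sup>+x\<in>R. ennreal \<bar>c * f x - average (\<lambda>x. c * f x) R\<bar> \<partial>lebesgue) / emeasure lebesgue R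
      = ennreal \<bar>c\<bar> * ((\<integral>\<^sup>+x\<in>R. ennreal \<bar>f x - average f R\<bar> \<partial>lebesgue) / emeasure lebesgue R)"
    by (simp add: ennreal_times_divide)
qed

text \<open>
  Test functions need not be normalised. A nonzero BMO norm is scaled to one. If the norm is zero,
  then \<open>f\<close> is almost everywhere constant on \<open>Q\<close> and the left-hand side vanishes.
\<close>

lemma weighted_oscillation_le_cp_bmo_const:
  fixes f w :: "real ^ 'n \<Rightarrow> real"
  assumes f: "locally_integrable f" and "bmo_norm f \<le> ennreal B" and Q: "cube Q"
    and w: "locally_integrable w"
  shows "1 / cp_mass p w Q * (\<integral>\<^sup>+x\<in>Q. ennreal (\<bar>f x - average f Q\<bar> * w x) \<partial>lebesgue)
    \<le> ennreal B * cp_bmo_const p w"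
proof -
  obtain b l where R: "l > 0" "Q = ccube b l" using Q by (auto elim: cubeE)
  have m: "(\<lambda>x. ennreal \<bar>f x - average f Q\<bar> * indicator Q x) \<in> borel_measurable lebesgue"
    unfolding R(2) by (intro borel_measurable_abs_diff_indicator set_integrable_ccube f) auto
  obtain \<beta> where \<beta>: "bmo_norm f = ennreal \<beta>" "\<beta> \<ge> 0"
    using assms(2) by (cases "bmo_norm f") (auto simp: top_unique)
  show ?thesis
  proof (cases "\<beta> = 0")
    case True
    have "(\<integral>\<^sup>+x\<in>Q. ennreal \<bar>f x - average f Q\<bar> \<partial>lebesgue) / emeasure lebesgue Q \<le> bmo_norm f"
      unfolding bmo_norm_def using Q by (intro SUP_upper) auto
    then have "(\<integral>\<^sup>+x\<in>Q. ennreal \<bar>f x - average f Q\<bar> \<partial>lebesgue) = 0"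
      using True \<beta> R by (auto simp: emeasure_lborel_ccube)
    then have "AE x in lebesgue. ennreal \<bar>f x - average f Q\<bar> * indicator Q x = 0"
      using m by (simp add: nn_integral_0_iff_AE)
    then have "(\<integral>\<^sup>+x\<in>Q. ennreal (\<bar>f x - average f Q\<bar> * w x) \<partial>lebesgue) = (\<integral>\<^sup>+x. 0 \<partial>(lebesgue :: (real ^ 'n) measure))"
      by (intro nn_integral_cong_AE) (auto elim!: eventually_mono split: split_indicator_asm split_indicator)
    then show ?thesis by simp
  next
    case False
    then have "\<beta> > 0" using \<beta> by simp
    define h where "h = (\<lambda>x. 1 / \<beta> * f x)"
    have h: "locally_integrable h"
      unfolding locally_integrable_def h_def
      using f by (auto simp: locally_integrable_def)
    have "bmo_norm h = 1"
      unfolding h_def bmo_norm_cmult[OF f] \<beta>(1) using \<open>\<beta> > 0\<close> by (simp add: ennreal_mult[symmetric])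
    have "1 / cp_mass p w Q * (\<integral>\<^sup>+x\<in>Q. ennreal (\<bar>h x - average h Q\<bar> * w x) \<partial>lebesgue) \<le> cp_bmo_const p w"
      unfolding cp_bmo_const_def using h \<open>bmo_norm h = 1\<close> Q
      by (intro SUP_upper2[of h] SUP_upper) auto
    then have le: "ennreal \<beta> * (1 / cp_mass p w Q * (\<integral>\<^sup>+x\<in>Q. ennreal (\<bar>h x - average h Q\<bar> * w x) \<partial>lebesgue))
       \<le> ennreal \<beta> * cp_bmo_const p w"
      by (intro mult_left_mono) auto
    have "(\<integral>\<^sup>+x\<in>Q. ennreal (\<bar>f x - average f Q\<bar> * w x) \<partial>lebesgue)
        \<le> (\<integral>\<^sup>+x. ennreal \<beta> * (ennreal (\<bar>h x - average h Q\<bar> * w x) * indicator Q x) \<partial>lebesgue)"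
    proof (intro nn_integral_mono)
      fix x
      have "\<bar>f x - average f Q\<bar> = \<beta> * \<bar>h x - average h Q\<bar>"
        unfolding h_def average_cmult right_diff_distrib[symmetric] abs_mult using \<open>\<beta> > 0\<close> by simp
      then show "ennreal (\<bar>f x - average f Q\<bar> * w x) * indicator Q x \<le>
          ennreal \<beta> * (ennreal (\<bar>h x - average h Q\<bar> * w x) * indicator Q x)"
        using \<open>\<beta> > 0\<close> by (simp add: mult.assoc ennreal_mult' )
    qed
    also have "\<dots> = ennreal \<beta> * (\<integral>\<^sup>+x\<in>Q. ennreal (\<bar>h x - average h Q\<bar> * w x) \<partial>lebesgue)"
      unfolding R(2)
      by (intro nn_integral_cmult borel_measurable_weighted_oscillation set_integrable_ccube h w) auto
    finally have "1 / cp_mass p w Q * (\<integral>\<^sup>+x\<in>Q. ennreal (\<bar>f x - average f Q\<bar> * w x) \<partial>lebesgue)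
      \<le> ennreal \<beta> * (1 / cp_mass p w Q * (\<integral>\<^sup>+x\<in>Q. ennreal (\<bar>h x - average h Q\<bar> * w x) \<partial>lebesgue))"
      by (subst mult.left_commute) (intro mult_left_mono, auto)
    also note le
    also have "ennreal \<beta> * cp_bmo_const p w \<le> ennreal B * cp_bmo_const p w"
      using assms(2) \<beta> by (intro mult_right_mono) auto
    finally show ?thesis .
  qed
qed

section \<open>Bounding the maximal function by oscillations\<close>

lemma average_half_space:
  fixes a :: "real ^ 'n"
  assumes "l > 0"
  shows "average (indicator {x. x $ i \<le> a $ i + l / 2}) (ccube a l) = 1 / 2"
proof -
  define b :: "real ^ 'n" where "b = (\<chi> j. if j = i then a $ j + l / 2 else a $ j + l)"
  have b: "b $ i = a $ i + l / 2" "\<And>j. j \<noteq> i \<Longrightarrow> b $ j = a $ j + l"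
    by (simp_all add: b_def)
  have le: "b $ j \<le> a $ j + l" for j using \<open>l > 0\<close> by (cases "j = i") (simp_all add: b)
  have eq: "ccube a l \<inter> {x. x $ i \<le> a $ i + l / 2} = cbox a b"
  proof (intro equalityI subsetI)
    fix x assume x: "x \<in> ccube a l \<inter> {x. x $ i \<le> a $ i + l / 2}"
    then have *: "a $ j \<le> x $ j \<and> x $ j \<le> a $ j + l" for j by (auto simp: mem_ccube)
    have "a $ j \<le> x $ j \<and> x $ j \<le> b $ j" for j
      using *[of j] x b by (cases "j = i") auto
    then show "x \<in> cbox a b" by (simp add: mem_box_cart)
  next
    fix x assume "x \<in> cbox a b"
    then have *: "a $ j \<le> x $ j" "x $ j \<le> b $ j" for j by (simp_all add: mem_box_cart)
    then show "x \<in> ccube a l \<inter> {x. x $ i \<le> a $ i + l / 2}"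
      using *(2)[of i] order_trans[OF *(2) le] by (simp add: mem_ccube b)
  qed
  have ne: "cbox a b \<noteq> {}" using \<open>l > 0\<close> by (simp add: interval_eq_empty_cart b_def not_less)
  have "(LINT x:ccube a l|lebesgue. indicator {x. x $ i \<le> a $ i + l / 2} x)
      = (LINT x|lebesgue. indicat_real (cbox a b) x)"
    unfolding set_lebesgue_integral_def eq[symmetric]
    by (intro Bochner_Integration.integral_cong) (auto split: split_indicator)
  also have "\<dots> = measure lebesgue (cbox a b)" by simp
  also have "\<dots> = (\<Prod>j\<in>UNIV. b $ j - a $ j)"
    using ne by (simp add: content_cbox_cart)
  also have "\<dots> = (\<Prod>j\<in>UNIV. if j = i then l / 2 else l)"
    by (intro prod.cong) (auto simp: b)
  also have "\<dots> = l / 2 * l ^ (CARD('n) - 1)"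
    by (subst prod.remove[of _ i]) (auto simp: card_Diff_singleton intro!: prod.cong)
  also have "\<dots> = l ^ CARD('n) / 2"
    using power_minus_mult[of "CARD('n)" l] by (simp add: mult.commute)
  finally show ?thesis using \<open>l > 0\<close> by (simp add: average_def content_ccube)
qed

lemma nn_integral_restrict_weight:
  fixes w :: "real ^ 'n \<Rightarrow> real"
  assumes "\<And>x. 0 \<le> w x"
  shows "(\<integral>\<^sup>+x. h x * ennreal \<bar>w x * indicator Q x\<bar> \<partial>lebesgue) = (\<integral>\<^sup>+x\<in>Q. h x * ennreal (w x) \<partial>lebesgue)"
  using assms by (intro nn_integral_cong) (auto split: split_indicator)

lemma finite_nn_integral_weight:
  fixes w :: "real ^ 'n \<Rightarrow> real"
  assumes w: "locally_integrable w" and w0: "\<And>x. 0 \<le> w x"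
  shows "(\<integral>\<^sup>+x\<in>ccube b l. ennreal (w x) \<partial>lebesgue) < \<infinity>"
proof -
  have "integrable lebesgue (\<lambda>x. w x * indicator (ccube b l) x)"
    using set_integrable_ccube[OF w, of b l] by (simp add: set_integrable_def mult.commute)
  then have "(\<integral>\<^sup>+x. ennreal (norm (w x * indicator (ccube b l) x)) \<partial>lebesgue) < \<infinity>"
    by (simp add: integrable_iff_bounded)
  also have "(\<integral>\<^sup>+x. ennreal (norm (w x * indicator (ccube b l) x)) \<partial>lebesgue)
      = (\<integral>\<^sup>+x\<in>ccube b l. ennreal (w x) \<partial>lebesgue)"
    using w0 by (intro nn_integral_cong) (auto split: split_indicator)
  finally show ?thesis .
qed

lemma weighted_integral_eq_oscillation_half_space:
  fixes w :: "real ^ 'n \<Rightarrow> real"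
  assumes w: "locally_integrable w" and "l > 0"
  shows "(\<integral>\<^sup>+x\<in>ccube b l. ennreal (w x) \<partial>lebesgue)
    = 2 * (\<integral>\<^sup>+x\<in>ccube b l. ennreal (\<bar>indicator {x. x $ i \<le> b $ i + l / 2} x
            - average (indicator {x. x $ i \<le> b $ i + l / 2}) (ccube b l)\<bar> * w x) \<partial>lebesgue)"
proof -
  have m: "(\<lambda>x. ennreal (w x) * indicator (ccube b l) x) \<in> borel_measurable lebesgue"
  proof -
    note [measurable] = set_integrable_measurable[OF set_integrable_ccube[OF w, of b l]]
    have "(\<lambda>x. ennreal (w x) * indicator (ccube b l) x) = (\<lambda>x. ennreal (w x * indicator (ccube b l) x))"
      by (auto split: split_indicator)
    then show ?thesis by simp
  qed
  have "(\<integral>\<^sup>+x\<in>ccube b l. ennreal (\<bar>indicator {x. x $ i \<le> b $ i + l / 2} x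
            - average (indicator {x. x $ i \<le> b $ i + l / 2}) (ccube b l)\<bar> * w x) \<partial>lebesgue)
     = (\<integral>\<^sup>+x. ennreal (1 / 2) * (ennreal (w x) * indicator (ccube b l) x) \<partial>lebesgue)"
    unfolding average_half_space[OF \<open>l > 0\<close>]
  proof (rule nn_integral_cong)
    fix x
    have half: "\<bar>indicat_real {x. x $ i \<le> b $ i + l / 2} x - 1 / 2\<bar> = 1 / 2" by (auto split: split_indicator)
    show "ennreal (\<bar>indicat_real {x. x $ i \<le> b $ i + l / 2} x - 1 / 2\<bar> * w x) * indicator (ccube b l) x
        = ennreal (1 / 2) * (ennreal (w x) * indicator (ccube b l) x)"
      unfolding half by (subst ennreal_mult') (auto simp: mult.assoc)
  qed
  also have "\<dots> = ennreal (1 / 2) * (\<integral>\<^sup>+x\<in>ccube b l. ennreal (w x) \<partial>lebesgue)"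
    by (rule nn_integral_cmult[OF m])
  finally have eq: "(\<integral>\<^sup>+x\<in>ccube b l. ennreal (\<bar>indicator {x. x $ i \<le> b $ i + l / 2} x
            - average (indicator {x. x $ i \<le> b $ i + l / 2}) (ccube b l)\<bar> * w x) \<partial>lebesgue)
     = ennreal (1 / 2) * (\<integral>\<^sup>+x\<in>ccube b l. ennreal (w x) \<partial>lebesgue)" .
  have "2 * ennreal (1 / 2) = 1"
    by (subst ennreal_numeral[symmetric], subst ennreal_mult[symmetric]) auto
  then show ?thesis unfolding eq mult.assoc[symmetric] by simp
qed

lemma indicator_locally_integrable:
  fixes S :: "(real ^ 'n) set"
  assumes "S \<in> sets lebesgue"
  shows "locally_integrable (indicator S)"
  unfolding locally_integrable_def set_integrable_def
proof (intro allI impI)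
  fix K :: "(real ^ 'n) set" assume "compact K"
  then have "K \<in> lmeasurable" by (rule lmeasurable_compact)
  then have "K \<inter> S \<in> lmeasurable" using assms by (rule fmeasurable_Int_fmeasurable)
  then have "integrable lebesgue (indicat_real (K \<inter> S))"
    by (intro integrable_real_indicator) (auto simp: fmeasurable_def)
  also have "indicat_real (K \<inter> S) = (\<lambda>x. indicat_real K x *\<^sub>R indicat_real S x)"
    by (auto split: split_indicator)
  finally show "integrable lebesgue (\<lambda>x. indicat_real K x *\<^sub>R indicat_real S x)" .
qed

lemma bmo_norm_indicator_le:
  fixes S :: "(real ^ 'n) set"
  assumes "S \<in> sets lebesgue"
  shows "bmo_norm (indicator S) \<le> ennreal 2"
proof -
  have "bmo_norm (indicator S) \<le> ennreal (2 * 1)"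
  proof (rule bmo_norm_le)
    fix b :: "real ^ 'n" and l :: real assume "l > 0"
    have "(\<integral>\<^sup>+x\<in>ccube b l. ennreal \<bar>indicat_real S x - 0\<bar> \<partial>lebesgue) \<le> (\<integral>\<^sup>+x. indicator (ccube b l) x \<partial>lebesgue)"
      by (intro nn_integral_mono) (auto split: split_indicator)
    also have "\<dots> = ennreal (1 * l ^ CARD('n))"
      using \<open>l > 0\<close> by (simp add: emeasure_lborel_ccube)
    finally show "\<exists>c. (\<integral>\<^sup>+x\<in>ccube b l. ennreal \<bar>indicat_real S x - c\<bar> \<partial>lebesgue) \<le> ennreal (1 * l ^ CARD('n))"
      by blast
  qed (use assms indicator_locally_integrable in auto)
  then show ?thesis by simp
qed

text \<open>
  The test function is the level count of \<open>M (w \<chi>\<^sub>Q)\<close> with base level \<open>a = w\<^sub>Q\<close>. For this \<open>a\<close> the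
  total count is at most \<open>2 K |Q|\<close>, where \<open>K\<close> is the covering constant, so the average of
  the test function over \<open>Q\<close> is at most \<open>2 K\<close> and \<open>\<integral>\<^sub>Q f w\<close> exceeds the weighted oscillation by
  at most \<open>2 K w(Q)\<close>. If \<open>w\<close> has no mass on \<open>Q\<close>, the left-hand integral is zero and the zero function serves.
\<close>

lemma hl_maximal_weight_le_oscillation:
  fixes w :: "real ^ 'n \<Rightarrow> real"
  assumes w: "locally_integrable w" and w0: "\<And>x. 0 \<le> w x" and "l > 0"
  shows "\<exists>f. locally_integrable f
      \<and> bmo_norm f \<le> ennreal (4 * (vitali_const TYPE('n) * 3 ^ CARD('n)))
      \<and> (\<integral>\<^sup>+x\<in>ccube b l. hl_maximal (\<lambda>y. w y * indicator (ccube b l) y) x \<partial>lebesgue)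
        \<le> ennreal (1 + 4 * (vitali_const TYPE('n))\<^sup>2) * (\<integral>\<^sup>+x\<in>ccube b l. ennreal (w x) \<partial>lebesgue)
         + ennreal (2 * vitali_const TYPE('n)) *
            (\<integral>\<^sup>+x\<in>ccube b l. ennreal (\<bar>f x - average f (ccube b l)\<bar> * w x) \<partial>lebesgue)"
proof -
  let ?K = "vitali_const TYPE('n)" and ?Q = "ccube b l"
  let ?K2 = "vitali_const TYPE('n) * 3 ^ CARD('n)"
  have K: "?K \<ge> 1" by (rule vitali_const_ge_1)
  define g where "g = (\<lambda>y. w y * indicator ?Q y)"
  have g [measurable]: "g \<in> borel_measurable lebesgue"
    unfolding g_def by (rule set_integrable_measurable[OF set_integrable_ccube[OF w]])
  have gint: "(\<integral>\<^sup>+x. ennreal \<bar>g x\<bar> \<partial>lebesgue) = (\<integral>\<^sup>+x\<in>?Q. ennreal (w x) \<partial>lebesgue)"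
    unfolding g_def using nn_integral_restrict_weight[where h="\<lambda>_. 1" and Q="?Q", OF w0] by simp
  have fin: "(\<integral>\<^sup>+x. ennreal \<bar>g x\<bar> \<partial>lebesgue) < \<infinity>"
    unfolding gint by (rule finite_nn_integral_weight[OF w w0])
  obtain W where W: "(\<integral>\<^sup>+x\<in>?Q. ennreal (w x) \<partial>lebesgue) = ennreal W" "W \<ge> 0"
    using fin unfolding gint by (cases "\<integral>\<^sup>+x\<in>?Q. ennreal (w x) \<partial>lebesgue") auto
  show ?thesis
  proof (cases "W = 0")
    case True
    have "hl_maximal g x = 0" for x
    proof -
      have "(\<integral>\<^sup>+y\<in>R. ennreal \<bar>g y\<bar> \<partial>lebesgue) \<le> (\<integral>\<^sup>+y. ennreal \<bar>g y\<bar> \<partial>lebesgue)" for R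
        by (intro nn_integral_mono) (auto split: split_indicator)
      then have "(\<integral>\<^sup>+y\<in>R. ennreal \<bar>g y\<bar> \<partial>lebesgue) = 0" for R
        using gint W True by simp
      then have "hl_maximal g x \<le> 0" unfolding hl_maximal_def by (intro SUP_least) simp
      then show ?thesis by simp
    qed
    then have "(\<integral>\<^sup>+x\<in>?Q. hl_maximal g x \<partial>lebesgue) = 0" by simp
    moreover have "bmo_norm (indicator {} :: real ^ 'n \<Rightarrow> real) \<le> ennreal (4 * ?K2)"
    proof -
      have "1 * 1 \<le> ?K2" by (intro mult_mono K) (use K in auto)
      then have "ennreal 2 \<le> ennreal (4 * ?K2)" by (intro ennreal_leI) linarith
      then show ?thesis by (rule order_trans[OF bmo_norm_indicator_le, rotated]) simp
    qed
    ultimately show ?thesis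
      unfolding g_def by (intro exI[of _ "indicator {}"]) (simp add: indicator_locally_integrable)
  next
    case False
    then have "W > 0" using W by simp
    define a where "a = W / l ^ CARD('n)"
    have "a > 0" using \<open>W > 0\<close> \<open>l > 0\<close> by (simp add: a_def)
    define f where "f = (\<lambda>x. enn2real (level_count a g x))"
    have fm [measurable]: "f \<in> borel_measurable lebesgue" unfolding f_def by measurable
    have f0: "f x \<ge> 0" for x by (simp add: f_def)
    have ae: "AE x in lebesgue. level_count a g x = ennreal (f x)"
      using AE_level_count_finite[OF g fin \<open>a > 0\<close>]
      by eventually_elim (simp add: f_def)
    have fint: "(\<integral>\<^sup>+x. ennreal (f x) \<partial>lebesgue) \<le> ennreal (2 * ?K * l ^ CARD('n))"
    proof -
      have "(\<integral>\<^sup>+x. ennreal (f x) \<partial>lebesgue) = (\<integral>\<^sup>+x. level_count a g x \<partial>lebesgue)"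
        using ae by (intro nn_integral_cong_AE) auto
      also have "\<dots> \<le> ennreal (2 * ?K / a) * ennreal W"
        using nn_integral_level_count_le[OF g fin \<open>a > 0\<close>] unfolding gint W .
      also have "\<dots> = ennreal (2 * ?K * l ^ CARD('n))"
        using K \<open>W > 0\<close> \<open>l > 0\<close> by (subst ennreal_mult[symmetric]) (simp_all add: a_def)
      finally show ?thesis .
    qed
    have fI: "integrable lebesgue f"
    proof (rule integrableI_bounded)
      show "(\<integral>\<^sup>+x. ennreal (norm (f x)) \<partial>lebesgue) < \<infinity>"
        using le_less_trans[OF fint ennreal_less_top] f0 by simp
    qed simp
    have floc: "locally_integrable f"
      unfolding locally_integrable_def set_integrable_def
    proof (intro allI impI)
      fix K :: "(real ^ 'n) set" assume "compact K"
      then have "K \<in> sets lebesgue" by (intro fmeasurableD lmeasurable_compact)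
      then show "integrable lebesgue (\<lambda>x. indicat_real K x *\<^sub>R f x)"
        by (rule integrable_mult_indicator[OF _ fI])
    qed
    have bmo: "bmo_norm f \<le> ennreal (2 * (2 * ?K2))"
    proof (rule bmo_norm_le[OF floc])
      show "0 \<le> 2 * ?K2" using K by simp
      show "\<exists>c. (\<integral>\<^sup>+x\<in>ccube b l. ennreal \<bar>f x - c\<bar> \<partial>lebesgue) \<le> ennreal (2 * ?K2 * l ^ CARD('n))"
        if "l > 0" for b l
        unfolding f_def by (rule level_count_oscillation[OF g fin \<open>a > 0\<close> that])
    qed
    have avg: "0 \<le> average f ?Q" "average f ?Q \<le> 2 * ?K"
    proof -
      have eq: "(LINT x:?Q|lebesgue. f x) = integral\<^sup>L lebesgue (\<lambda>x. indicator ?Q x * f x)"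
        by (simp add: set_lebesgue_integral_def)
      have "integral\<^sup>L lebesgue (\<lambda>x. indicator ?Q x * f x) \<le> integral\<^sup>L lebesgue f"
        using set_integrable_ccube[OF floc, of b l] fI f0 unfolding set_integrable_def
        by (intro integral_mono) (auto split: split_indicator)
      also have "ennreal (integral\<^sup>L lebesgue f) = (\<integral>\<^sup>+x. ennreal (f x) \<partial>lebesgue)"
        using f0 by (intro nn_integral_eq_integral[symmetric] fI) auto
      then have "ennreal (integral\<^sup>L lebesgue f) \<le> ennreal (2 * ?K * l ^ CARD('n))"
        using fint by (simp only:)
      then have "integral\<^sup>L lebesgue f \<le> 2 * ?K * l ^ CARD('n)"
        using K \<open>l > 0\<close> by (subst (asm) ennreal_le_iff) simp_all
      finally show "average f ?Q \<le> 2 * ?K"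
        unfolding average_def eq measure_ccube[OF less_imp_le[OF \<open>l > 0\<close>]]
        using \<open>l > 0\<close> by (simp add: pos_divide_le_eq)
      show "0 \<le> average f ?Q"
        unfolding average_def eq using f0 by (intro divide_nonneg_nonneg integral_nonneg_AE) auto
    qed
    have wm [measurable]: "(\<lambda>x. ennreal (w x) * indicator ?Q x) \<in> borel_measurable lebesgue"
    proof -
      have "(\<lambda>x. ennreal (w x) * indicator ?Q x) = (\<lambda>x. ennreal (g x))"
        by (auto simp: g_def split: split_indicator)
      then show ?thesis by simp
    qed
    have fw: "(\<integral>\<^sup>+x. level_count a g x * ennreal \<bar>g x\<bar> \<partial>lebesgue)
       \<le> (\<integral>\<^sup>+x\<in>?Q. ennreal (\<bar>f x - average f ?Q\<bar> * w x) \<partial>lebesgue) + ennreal (2 * ?K) * ennreal W"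
    proof -
      have "(\<integral>\<^sup>+x. level_count a g x * ennreal \<bar>g x\<bar> \<partial>lebesgue)
         = (\<integral>\<^sup>+x. ennreal (f x) * ennreal \<bar>g x\<bar> \<partial>lebesgue)"
        using ae by (intro nn_integral_cong_AE) auto
      also have "\<dots> = (\<integral>\<^sup>+x\<in>?Q. ennreal (f x) * ennreal (w x) \<partial>lebesgue)"
        unfolding g_def by (rule nn_integral_restrict_weight[OF w0])
      also have "\<dots> \<le> (\<integral>\<^sup>+x. ennreal (\<bar>f x - average f ?Q\<bar> * w x) * indicator ?Q x
            + ennreal (2 * ?K) * (ennreal (w x) * indicator ?Q x) \<partial>lebesgue)"
      proof (rule nn_integral_mono)
        fix x
        have "f x * w x \<le> (\<bar>f x - average f ?Q\<bar> + 2 * ?K) * w x"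
          using avg w0[of x] by (intro mult_right_mono) auto
        then have "ennreal (f x * w x) \<le> ennreal (\<bar>f x - average f ?Q\<bar> * w x) + ennreal (2 * ?K * w x)"
          using w0[of x] K by (simp add: ennreal_plus[symmetric] distrib_right ennreal_leI del: ennreal_plus)
        then show "ennreal (f x) * ennreal (w x) * indicator ?Q x \<le>
            ennreal (\<bar>f x - average f ?Q\<bar> * w x) * indicator ?Q x + ennreal (2 * ?K) * (ennreal (w x) * indicator ?Q x)"
          using w0[of x] f0[of x] K by (simp add: ennreal_mult[symmetric] split: split_indicator)
      qed
      also have "\<dots> = (\<integral>\<^sup>+x\<in>?Q. ennreal (\<bar>f x - average f ?Q\<bar> * w x) \<partial>lebesgue)
          + ennreal (2 * ?K) * (\<integral>\<^sup>+x\<in>?Q. ennreal (w x) \<partial>lebesgue)"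
        by (subst nn_integral_add)
          (auto intro!: borel_measurable_weighted_oscillation set_integrable_ccube floc w nn_integral_cmult wm)
      finally show ?thesis unfolding W .
    qed
    have "(\<integral>\<^sup>+x\<in>?Q. hl_maximal g x \<partial>lebesgue)
      \<le> ennreal a * emeasure lebesgue ?Q + ennreal (2 * ?K) * (\<integral>\<^sup>+x. level_count a g x * ennreal \<bar>g x\<bar> \<partial>lebesgue)"
      by (rule nn_integral_hl_maximal_le[OF g fin \<open>a > 0\<close>]) auto
    also have "ennreal a * emeasure lebesgue ?Q = ennreal W"
      using \<open>a > 0\<close> \<open>l > 0\<close> by (simp add: emeasure_lborel_ccube ennreal_mult[symmetric] a_def)
    also have "ennreal W + ennreal (2 * ?K) * (\<integral>\<^sup>+x. level_count a g x * ennreal \<bar>g x\<bar> \<partial>lebesgue)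
       \<le> ennreal W + ennreal (2 * ?K) * ((\<integral>\<^sup>+x\<in>?Q. ennreal (\<bar>f x - average f ?Q\<bar> * w x) \<partial>lebesgue) + ennreal (2 * ?K) * ennreal W)"
      by (intro add_left_mono mult_left_mono fw) auto
    also have "\<dots> = (ennreal W + ennreal (2 * ?K) * (ennreal (2 * ?K) * ennreal W))
         + ennreal (2 * ?K) * (\<integral>\<^sup>+x\<in>?Q. ennreal (\<bar>f x - average f ?Q\<bar> * w x) \<partial>lebesgue)"
      by (simp add: distrib_left add_ac)
    also have "ennreal W + ennreal (2 * ?K) * (ennreal (2 * ?K) * ennreal W) = ennreal ((1 + 4 * ?K\<^sup>2) * W)"
      using K W(2) by (simp add: ennreal_mult[symmetric] ennreal_plus[symmetric] algebra_simps power2_eq_square del: ennreal_plus)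
    also have "\<dots> = ennreal (1 + 4 * ?K\<^sup>2) * (\<integral>\<^sup>+x\<in>?Q. ennreal (w x) \<partial>lebesgue)"
      unfolding W using W(2) by (simp add: ennreal_mult)
    finally show ?thesis
      using floc bmo unfolding g_def by (intro exI[of _ f]) simp
  qed
qed

text \<open>
  The level count accounts for the oscillation term of the preceding estimate, and a half space
  bisecting \<open>Q\<close> accounts for the term \<open>w(Q)\<close>.
\<close>

lemma cp_const_le_cp_bmo_const:
  fixes w :: "real ^ 'n \<Rightarrow> real"
  assumes w: "locally_integrable w" and w0: "\<And>x. 0 \<le> w x"
  shows "cp_const p w \<le> ennreal (4 * (1 + 4 * (vitali_const TYPE('n))\<^sup>2)
      + 8 * vitali_const TYPE('n) * (vitali_const TYPE('n) * 3 ^ CARD('n))) * cp_bmo_const p w"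
  unfolding cp_const_def
proof (rule SUP_least)
  fix Q :: "(real ^ 'n) set" assume "Q \<in> {Q. cube Q}"
  then have cQ: "cube Q" by simp
  then obtain b l where Q: "l > 0" "Q = ccube b l" by (rule cubeE)
  let ?K = "vitali_const TYPE('n)"
  let ?K2 = "vitali_const TYPE('n) * 3 ^ CARD('n)"
  have K: "?K \<ge> 1" by (rule vitali_const_ge_1)
  let ?m = "1 / cp_mass p w Q" and ?B = "cp_bmo_const p w"
  let ?osc = "\<lambda>f. \<integral>\<^sup>+x\<in>Q. ennreal (\<bar>f x - average f Q\<bar> * w x) \<partial>lebesgue"
  obtain f where f: "locally_integrable f" "bmo_norm f \<le> ennreal (4 * ?K2)"
     and le: "(\<integral>\<^sup>+x\<in>Q. hl_maximal (\<lambda>y. w y * indicator Q y) x \<partial>lebesgue)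
        \<le> ennreal (1 + 4 * ?K\<^sup>2) * (\<integral>\<^sup>+x\<in>Q. ennreal (w x) \<partial>lebesgue) + ennreal (2 * ?K) * ?osc f"
    using hl_maximal_weight_le_oscillation[OF w w0 Q(1), of b] unfolding Q(2) by blast
  \<comment> \<open>Any coordinate direction will do for the bisecting half space.\<close>
  obtain i :: 'n where True by simp
  define h :: "real ^ 'n \<Rightarrow> real" where "h = indicator {x. x $ i \<le> b $ i + l / 2}"
  have H: "{x. x $ i \<le> b $ i + l / 2} \<in> sets lebesgue"
    by (intro sets_completionI_sets) (simp add: closed_halfspace_component_le_cart)
  have h: "locally_integrable h" "bmo_norm h \<le> ennreal 2"
    unfolding h_def by (rule indicator_locally_integrable[OF H] bmo_norm_indicator_le[OF H])+
  have wh: "(\<integral>\<^sup>+x\<in>Q. ennreal (w x) \<partial>lebesgue) = 2 * ?osc h"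
    unfolding Q(2) h_def by (rule weighted_integral_eq_oscillation_half_space[OF w Q(1)])
  have "?m * (\<integral>\<^sup>+x\<in>Q. hl_maximal (\<lambda>y. w y * indicator Q y) x \<partial>lebesgue)
     \<le> ?m * (ennreal (1 + 4 * ?K\<^sup>2) * (2 * ?osc h) + ennreal (2 * ?K) * ?osc f)"
    using le unfolding wh by (intro mult_left_mono) auto
  also have "\<dots> = ennreal (1 + 4 * ?K\<^sup>2) * (2 * (?m * ?osc h)) + ennreal (2 * ?K) * (?m * ?osc f)"
    by (simp only: distrib_left mult.left_commute)
  also have "\<dots> \<le> ennreal (1 + 4 * ?K\<^sup>2) * (2 * (ennreal 2 * ?B)) + ennreal (2 * ?K) * (ennreal (4 * ?K2) * ?B)"
    by (intro add_mono mult_left_mono weighted_oscillation_le_cp_bmo_const f h cQ w) auto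
  also have "\<dots> = (ennreal (1 + 4 * ?K\<^sup>2) * (ennreal 2 * ennreal 2) + ennreal (2 * ?K) * ennreal (4 * ?K2)) * ?B"
    by (simp add: distrib_right mult.assoc)
  also have "ennreal (1 + 4 * ?K\<^sup>2) * (ennreal 2 * ennreal 2) + ennreal (2 * ?K) * ennreal (4 * ?K2)
      = ennreal (4 * (1 + 4 * ?K\<^sup>2) + 8 * ?K * ?K2)"
    using K by (simp add: ennreal_mult[symmetric] ennreal_plus[symmetric] algebra_simps del: ennreal_plus ennreal_numeral)
  finally show "?m * (\<integral>\<^sup>+x\<in>Q. hl_maximal (\<lambda>y. w y * indicator Q y) x \<partial>lebesgue)
      \<le> ennreal (4 * (1 + 4 * ?K\<^sup>2) + 8 * ?K * ?K2) * ?B" .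
qed

section \<open>Dyadic cells\<close>

lemma locally_integrable_borel_measurable:
  fixes f :: "real ^ 'n \<Rightarrow> real"
  assumes "locally_integrable f"
  shows "f \<in> borel_measurable lebesgue"
proof (rule borel_measurable_LIMSEQ_real)
  show "(\<lambda>x. f x * indicator (cball 0 (real k)) x) \<in> borel_measurable lebesgue" for k
    using assms by (intro set_integrable_measurable) (simp add: locally_integrable_def)
  show "(\<lambda>k. f x * indicator (cball 0 (real k)) x) \<longlonglongrightarrow> f x" for x
  proof (rule tendsto_eventually)
    obtain m where m: "norm x \<le> real m" using real_arch_simple by blast
    show "\<forall>\<^sub>F k in sequentially. f x * indicator (cball 0 (real k)) x = f x"
      using eventually_ge_at_top[of m] by eventually_elim (use m in \<open>auto split: split_indicator\<close>)
  qed
qed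

lemma nn_integral_UN_disjoint:
  assumes h: "h \<in> borel_measurable M" and I: "finite I" "disjoint_family_on A I"
    and A: "\<And>i. i \<in> I \<Longrightarrow> A i \<in> sets M"
  shows "(\<integral>\<^sup>+x\<in>(\<Union>i\<in>I. A i). h x \<partial>M) = (\<Sum>i\<in>I. \<integral>\<^sup>+x\<in>A i. h x \<partial>M)"
proof -
  have UN: "(\<Union>i\<in>I. A i) \<in> sets M" using I A by auto
  have "(\<Sum>i\<in>I. emeasure (density M h) (A i)) = emeasure (density M h) (\<Union>i\<in>I. A i)"
    using I A by (intro sum_emeasure) auto
  then show ?thesis using h A UN by (simp add: emeasure_density)
qed

text \<open>
  Half-open cubes, so that the dyadic children partition their parent exactly. They differ
  from closed cubes by null sets, which changes neither integrals nor averages.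
\<close>

definition cell :: "real ^ 'n \<Rightarrow> real \<Rightarrow> (real ^ 'n) set" where
  "cell a l = {x. \<forall>i. a $ i \<le> x $ i \<and> x $ i < a $ i + l}"

lemma cell_subset_ccube: "cell a l \<subseteq> ccube a l"
  by (auto simp: cell_def mem_box_cart less_imp_le)

lemma ccube_minus_cell_null: "ccube a l - cell a l \<in> null_sets lebesgue"
proof -
  have "box a (\<chi> i. a $ i + l) \<subseteq> cell a l"
    by (auto simp: cell_def mem_box_cart less_imp_le)
  then have "ccube a l - cell a l \<subseteq> ccube a l - box a (\<chi> i. a $ i + l)" by blast
  then have "negligible (ccube a l - cell a l)"
    by (rule negligible_subset[OF negligible_frontier_interval])
  then show ?thesis by (simp add: negligible_iff_null_sets)
qed

lemma sets_cell [measurable, simp]: "cell a l \<in> sets lebesgue"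
proof -
  have "ccube a l - cell a l \<in> sets lebesgue"
    using ccube_minus_cell_null by (rule null_setsD2)
  then have "ccube a l - (ccube a l - cell a l) \<in> sets lebesgue"
    by (rule sets.Diff[rotated]) simp
  then show ?thesis by (simp only: double_diff[OF cell_subset_ccube subset_refl])
qed

lemma nn_integral_cell_eq: "(\<integral>\<^sup>+x\<in>cell a l. h x \<partial>lebesgue) = (\<integral>\<^sup>+x\<in>ccube a l. h x \<partial>lebesgue)"
proof (rule nn_integral_null_delta)
  have "cell a l - ccube a l = {}" using cell_subset_ccube by blast
  then show "cell a l - ccube a l \<union> (ccube a l - cell a l) \<in> null_sets lebesgue"
    using ccube_minus_cell_null[of a l] by (simp only: Un_empty_left)
qed auto

lemma emeasure_cell: "0 \<le> l \<Longrightarrow> emeasure lebesgue (cell a l :: (real ^ 'n) set) = ennreal (l ^ CARD('n))"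
  using nn_integral_cell_eq[of "\<lambda>_. 1" a l] by (simp add: emeasure_ccube del: emeasure_completion)

lemma lmeasurable_cell: "cell a l \<in> lmeasurable"
  by (rule fmeasurableI2[OF lmeasurable_cbox cell_subset_ccube]) simp

lemma measure_cell: "0 \<le> l \<Longrightarrow> measure lebesgue (cell a l :: (real ^ 'n) set) = l ^ CARD('n)"
  using emeasure_cell[of l a] by (simp add: measure_def del: emeasure_completion)

lemma measure_cell_pos: "0 < l \<Longrightarrow> measure lebesgue (cell a l :: (real ^ 'n) set) > 0"
  by (subst measure_cell) auto

lemma set_integrable_cell: "locally_integrable f \<Longrightarrow> set_integrable lebesgue (cell a l) f"
  using set_integrable_ccube[of f a l] by (rule set_integrable_subset) (auto simp: cell_subset_ccube)

lemma average_cell_eq: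
  fixes f :: "real ^ 'n \<Rightarrow> real"
  assumes "locally_integrable f" "0 \<le> l"
  shows "average f (cell a l) = average f (ccube a l)"
proof -
  note [measurable] = locally_integrable_borel_measurable[OF assms(1)]
  have [measurable]: "ccube a l \<in> sets lebesgue" by simp
  have "AE x in lebesgue. x \<notin> ccube a l - cell a l"
    by (rule AE_not_in[OF ccube_minus_cell_null])
  then have "(LINT x:cell a l|lebesgue. f x) = (LINT x:ccube a l|lebesgue. f x)"
    unfolding set_lebesgue_integral_def
    using cell_subset_ccube[of a l]
    by (intro integral_cong_AE) (auto elim!: eventually_mono split: split_indicator)
  then show ?thesis
    using assms(2) by (simp only: average_def measure_cell measure_ccube)
qed

definition subcorners :: "real ^ 'n \<Rightarrow> real \<Rightarrow> (real ^ 'n) set" where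
  "subcorners a l = range (\<lambda>F. \<chi> i. if F i then a $ i + l / 2 else a $ i)"

lemma finite_subcorners [simp]: "finite (subcorners a l)"
  unfolding subcorners_def by (rule finite_imageI) simp

lemma subcorners_nth: "v \<in> subcorners a l \<Longrightarrow> v $ i = a $ i \<or> v $ i = a $ i + l / 2"
  by (auto simp: subcorners_def)

lemma UN_subcorners:
  assumes "l > 0"
  shows "(\<Union>v\<in>subcorners a l. cell v (l / 2)) = cell a l"
proof (intro equalityI subsetI)
  fix x assume "x \<in> (\<Union>v\<in>subcorners a l. cell v (l / 2))"
  then obtain v where v: "v \<in> subcorners a l" "x \<in> cell v (l / 2)" by blast
  have "a $ i \<le> x $ i \<and> x $ i < a $ i + l" for i
    using subcorners_nth[OF v(1), of i] v(2)[unfolded cell_def, simplified, rule_format, of i] \<open>l > 0\<close> by auto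
  then show "x \<in> cell a l" by (simp add: cell_def)
next
  fix x assume x: "x \<in> cell a l"
  define v where "v = (\<chi> i. if a $ i + l / 2 \<le> x $ i then a $ i + l / 2 else a $ i)"
  have "v \<in> subcorners a l" unfolding subcorners_def v_def by (rule range_eqI) simp
  moreover have "v $ i \<le> x $ i \<and> x $ i < v $ i + l / 2" for i
    using x[unfolded cell_def, simplified, rule_format, of i] by (simp add: v_def)
  then have "x \<in> cell v (l / 2)" by (simp add: cell_def)
  ultimately show "x \<in> (\<Union>v\<in>subcorners a l. cell v (l / 2))" by blast
qed

lemma cell_subcorner_subset: "l > 0 \<Longrightarrow> v \<in> subcorners a l \<Longrightarrow> cell v (l / 2) \<subseteq> cell a l"
  using UN_subcorners[of l a] by blast

lemma disjoint_subcorners: "disjoint_family_on (\<lambda>v. cell v (l / 2)) (subcorners a l)"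
  unfolding disjoint_family_on_def
proof (intro ballI impI)
  fix u v assume uv: "u \<in> subcorners a l" "v \<in> subcorners a l" "u \<noteq> v"
  then obtain i where i: "u $ i \<noteq> v $ i" by (auto simp: vec_eq_iff)
  show "cell u (l / 2) \<inter> cell v (l / 2) = {}"
  proof (rule ccontr)
    assume "\<not> ?thesis"
    then obtain x where "x \<in> cell u (l / 2)" "x \<in> cell v (l / 2)" by blast
    then have "u $ i \<le> x $ i" "x $ i < u $ i + l / 2" "v $ i \<le> x $ i" "x $ i < v $ i + l / 2"
      by (auto simp: cell_def)
    then show False using i subcorners_nth[OF uv(1), of i] subcorners_nth[OF uv(2), of i] by auto
  qed
qed

lemma nn_integral_subcorners:
  assumes "l > 0" "h \<in> borel_measurable lebesgue"
  shows "(\<integral>\<^sup>+x\<in>cell a l. h x \<partial>lebesgue) = (\<Sum>v\<in>subcorners a l. \<integral>\<^sup>+x\<in>cell v (l / 2). h x \<partial>lebesgue)"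
  using nn_integral_UN_disjoint[OF assms(2) finite_subcorners disjoint_subcorners, of a l]
  by (simp add: UN_subcorners[OF assms(1)])

section \<open>A stopping time argument on dyadic cells\<close>

text \<open>
  The conditional expectation of \<open>f\<close> given the \<open>k\<close>-th dyadic generation of the cell, extended by zero
  outside the cell when \<open>k > 0\<close>. Recursion from the root down lets every later proof be an induction on \<open>k\<close>
  that passes from a cell to its children.
\<close>

primrec dyadic_average :: "nat \<Rightarrow> (real ^ 'n \<Rightarrow> real) \<Rightarrow> real ^ 'n \<Rightarrow> real \<Rightarrow> real ^ 'n \<Rightarrow> real" where
  "dyadic_average 0 f a l x = average f (cell a l)"
| "dyadic_average (Suc k) f a l x
    = (\<Sum>v\<in>subcorners a l. dyadic_average k f v (l / 2) x * indicator (cell v (l / 2)) x)"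

lemma borel_measurable_dyadic_average [measurable]:
  "dyadic_average k f a l \<in> borel_measurable lebesgue"
proof (induction k arbitrary: a l)
  case 0
  have "dyadic_average 0 f a l = (\<lambda>_. average f (cell a l))" by (rule ext) simp
  then show ?case by simp
next
  case (Suc k)
  have "dyadic_average (Suc k) f a l
      = (\<lambda>x. \<Sum>v\<in>subcorners a l. dyadic_average k f v (l / 2) x * indicator (cell v (l / 2)) x)"
    by (rule ext) (rule dyadic_average.simps(2))
  also have "\<dots> \<in> borel_measurable lebesgue"
    by (intro borel_measurable_sum borel_measurable_times Suc borel_measurable_indicator sets_cell)
  finally show ?case .
qed

lemma dyadic_average_Suc:
  assumes "v \<in> subcorners a l" "x \<in> cell v (l / 2)"
  shows "dyadic_average (Suc k) f a l x = dyadic_average k f v (l / 2) x"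
proof -
  have "dyadic_average (Suc k) f a l x = (\<Sum>u\<in>subcorners a l. if u = v then dyadic_average k f v (l / 2) x else 0)"
    unfolding dyadic_average.simps
  proof (rule sum.cong[OF refl])
    fix u assume u: "u \<in> subcorners a l"
    show "dyadic_average k f u (l / 2) x * indicator (cell u (l / 2)) x
        = (if u = v then dyadic_average k f v (l / 2) x else 0)"
    proof (cases "u = v")
      case False
      then have "cell u (l / 2) \<inter> cell v (l / 2) = {}"
        using disjoint_family_onD[OF disjoint_subcorners u assms(1)] by simp
      then show ?thesis using False assms(2) by (auto split: split_indicator)
    qed (use assms in simp)
  qed
  then show ?thesis using assms(1) by simp
qed

text \<open>
  The union of the maximal dyadic subcells, down to generation \<open>k\<close>, whose average of \<open>f\<close>
  differs from \<open>c\<close> by more than 2.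
\<close>

primrec stopping_set :: "nat \<Rightarrow> (real ^ 'n \<Rightarrow> real) \<Rightarrow> real \<Rightarrow> real ^ 'n \<Rightarrow> real \<Rightarrow> (real ^ 'n) set" where
  "stopping_set 0 f c a l = (if \<bar>average f (cell a l) - c\<bar> > 2 then cell a l else {})"
| "stopping_set (Suc k) f c a l = (if \<bar>average f (cell a l) - c\<bar> > 2 then cell a l
     else (\<Union>v\<in>subcorners a l. stopping_set k f c v (l / 2)))"

lemma sets_stopping_set [measurable, simp]: "stopping_set k f c a l \<in> sets lebesgue"
  by (induction k arbitrary: a l) auto

lemma stopping_set_subset: "l > 0 \<Longrightarrow> stopping_set k f c a l \<subseteq> cell a l"
proof (induction k arbitrary: a l)
  case (Suc k)
  have "stopping_set k f c v (l / 2) \<subseteq> cell a l" if "v \<in> subcorners a l" for v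
    using Suc.IH[of "l / 2" v] cell_subcorner_subset[OF Suc.prems that] Suc.prems by auto
  then show ?case by auto
qed simp

lemma stopping_set_all: "\<bar>average f (cell a l) - c\<bar> > 2 \<Longrightarrow> stopping_set k f c a l = cell a l"
  by (cases k) auto

text \<open>
  The dyadic weak type inequality for \<open>f - c\<close>: on a selected cell the mean of \<open>|f - c|\<close> exceeds 2, and
  the selected cells are disjoint.
\<close>

lemma emeasure_stopping_set_le:
  fixes f :: "real ^ 'n \<Rightarrow> real"
  assumes f: "locally_integrable f" and "l > 0"
  shows "2 * emeasure lebesgue (stopping_set k f c a l) \<le> (\<integral>\<^sup>+x\<in>cell a l. ennreal \<bar>f x - c\<bar> \<partial>lebesgue)"
  using \<open>l > 0\<close>
proof (induction k arbitrary: a l)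
  have stopped: "2 * emeasure lebesgue (stopping_set k f c a l) \<le> (\<integral>\<^sup>+x\<in>cell a l. ennreal \<bar>f x - c\<bar> \<partial>lebesgue)"
    if "\<bar>average f (cell a l) - c\<bar> > 2" "l > 0" for k a l
  proof -
    have "2 * emeasure lebesgue (stopping_set k f c a l)
        \<le> ennreal \<bar>average f (cell a l) - c\<bar> * emeasure lebesgue (cell a l)"
    proof (rule mult_mono)
      have "ennreal 2 \<le> ennreal \<bar>average f (cell a l) - c\<bar>" using that by (intro ennreal_leI) simp
      then show "2 \<le> ennreal \<bar>average f (cell a l) - c\<bar>" by simp
    qed (simp_all only: stopping_set_all[OF that(1)] order_refl zero_le)
    also have "\<dots> \<le> (\<integral>\<^sup>+x\<in>cell a l. ennreal \<bar>f x - c\<bar> \<partial>lebesgue)"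
      using that(2) by (intro average_minus_const_le set_integrable_cell f lmeasurable_cell measure_cell_pos)
    finally show ?thesis .
  qed
  {
    case base: 0
    then show ?case using stopped[of a l 0] by (cases "\<bar>average f (cell a l) - c\<bar> > 2") simp_all
  next
    case (Suc k)
    note [measurable] = locally_integrable_borel_measurable[OF f]
    show ?case
    proof (cases "\<bar>average f (cell a l) - c\<bar> > 2")
      case True
      then show ?thesis using Suc.prems by (rule stopped)
    next
      case False
      have "2 * emeasure lebesgue (stopping_set (Suc k) f c a l)
          \<le> 2 * (\<Sum>v\<in>subcorners a l. emeasure lebesgue (stopping_set k f c v (l / 2)))"
        using False by (auto simp del: emeasure_completion intro!: mult_left_mono emeasure_subadditive_finite)
      also have "\<dots> \<le> (\<Sum>v\<in>subcorners a l. \<integral>\<^sup>+x\<in>cell v (l / 2). ennreal \<bar>f x - c\<bar> \<partial>lebesgue)"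
        unfolding sum_distrib_left using Suc by (intro sum_mono) auto
      also have "\<dots> = (\<integral>\<^sup>+x\<in>cell a l. ennreal \<bar>f x - c\<bar> \<partial>lebesgue)"
        using Suc.prems by (intro nn_integral_subcorners[symmetric]) auto
      finally show ?thesis .
    qed
  }
qed

text \<open>
  The argument uses the weight and the maximal function only through the fact that the average of \<open>w\<close> over a
  cell is at most \<open>F\<close> at each of its points, and \<open>f\<close> only through its mean oscillation on cells.
\<close>

locale dyadic_testing =
  fixes f :: "real ^ 'n \<Rightarrow> real" and w F :: "real ^ 'n \<Rightarrow> ennreal"
  assumes f: "locally_integrable f"
    and w [measurable]: "w \<in> borel_measurable lebesgue"
    and F [measurable]: "F \<in> borel_measurable lebesgue"
    and oscillation: "\<And>a l. l > 0 \<Longrightarrow>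
      (\<integral>\<^sup>+x\<in>cell a l. ennreal \<bar>f x - average f (cell a l)\<bar> \<partial>lebesgue) \<le> ennreal (l ^ CARD('n))"
    and average_le: "\<And>a l x. l > 0 \<Longrightarrow> x \<in> cell a l \<Longrightarrow>
      (\<integral>\<^sup>+y\<in>cell a l. w y \<partial>lebesgue) \<le> ennreal (l ^ CARD('n)) * F x"
begin

lemma f_measurable [measurable]: "f \<in> borel_measurable lebesgue"
  by (rule locally_integrable_borel_measurable[OF f])

lemma average_jump_le:
  assumes "l > 0" "v \<in> subcorners a l"
  shows "\<bar>average f (cell v (l / 2)) - average f (cell a l)\<bar> \<le> 2 ^ CARD('n)"
proof -
  let ?d = "\<bar>average f (cell v (l / 2)) - average f (cell a l)\<bar>"
  have "ennreal ?d * emeasure lebesgue (cell v (l / 2))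
      \<le> (\<integral>\<^sup>+x\<in>cell v (l / 2). ennreal \<bar>f x - average f (cell a l)\<bar> \<partial>lebesgue)"
    using assms(1) by (intro average_minus_const_le set_integrable_cell f lmeasurable_cell measure_cell_pos) simp
  also have "\<dots> \<le> (\<integral>\<^sup>+x\<in>cell a l. ennreal \<bar>f x - average f (cell a l)\<bar> \<partial>lebesgue)"
    by (rule nn_set_integral_set_mono[OF cell_subcorner_subset[OF assms]])
  also have "\<dots> \<le> ennreal (l ^ CARD('n))" by (rule oscillation[OF assms(1)])
  also have "emeasure lebesgue (cell v (l / 2)) = ennreal ((l / 2) ^ CARD('n))"
    using assms(1) by (intro emeasure_cell) simp
  finally have "ennreal (?d * (l / 2) ^ CARD('n)) \<le> ennreal (l ^ CARD('n))"
    by (subst ennreal_mult) (use assms(1) in auto)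
  then have "?d * (l / 2) ^ CARD('n) \<le> l ^ CARD('n)"
    by (subst (asm) ennreal_le_iff) (use assms(1) in auto)
  then have "?d * l ^ CARD('n) \<le> 2 ^ CARD('n) * l ^ CARD('n)"
    by (simp add: power_divide field_simps)
  then show ?thesis using assms(1) by simp
qed

text \<open>
  One step down the dyadic tree: all terms are additive over the children of a cell that is not itself
  selected.
\<close>

lemma oscillation_split:
  assumes "l > 0" "\<bar>average f (cell a l) - c\<bar> \<le> 2"
    and IH: "\<And>v. v \<in> subcorners a l \<Longrightarrow>
       (\<integral>\<^sup>+x\<in>cell v (l / 2). ennreal \<bar>dyadic_average k f v (l / 2) x - c\<bar> * w x \<partial>lebesgue)
       \<le> \<beta> * (\<integral>\<^sup>+x\<in>cell v (l / 2). w x \<partial>lebesgue) + C * (\<integral>\<^sup>+x\<in>stopping_set k f c v (l / 2). F x \<partial>lebesgue)"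
  shows "(\<integral>\<^sup>+x\<in>cell a l. ennreal \<bar>dyadic_average (Suc k) f a l x - c\<bar> * w x \<partial>lebesgue)
     \<le> \<beta> * (\<integral>\<^sup>+x\<in>cell a l. w x \<partial>lebesgue) + C * (\<integral>\<^sup>+x\<in>stopping_set (Suc k) f c a l. F x \<partial>lebesgue)"
proof -
  have disj: "disjoint_family_on (\<lambda>v. stopping_set k f c v (l / 2)) (subcorners a l)"
    using disjoint_subcorners[of l a] stopping_set_subset[of "l / 2" k f c] \<open>l > 0\<close>
    unfolding disjoint_family_on_def by (meson disjoint_iff half_gt_zero subset_iff)
  have "(\<integral>\<^sup>+x\<in>cell a l. ennreal \<bar>dyadic_average (Suc k) f a l x - c\<bar> * w x \<partial>lebesgue)
     = (\<Sum>v\<in>subcorners a l. \<integral>\<^sup>+x\<in>cell v (l / 2). ennreal \<bar>dyadic_average (Suc k) f a l x - c\<bar> * w x \<partial>lebesgue)"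
    by (rule nn_integral_subcorners[OF \<open>l > 0\<close>]) measurable
  also have "\<dots> = (\<Sum>v\<in>subcorners a l. \<integral>\<^sup>+x\<in>cell v (l / 2). ennreal \<bar>dyadic_average k f v (l / 2) x - c\<bar> * w x \<partial>lebesgue)"
  proof (intro sum.cong refl nn_integral_cong)
    fix v x assume v: "v \<in> subcorners a l"
    show "ennreal \<bar>dyadic_average (Suc k) f a l x - c\<bar> * w x * indicator (cell v (l / 2)) x
        = ennreal \<bar>dyadic_average k f v (l / 2) x - c\<bar> * w x * indicator (cell v (l / 2)) x"
      by (cases "x \<in> cell v (l / 2)") (auto simp: dyadic_average_Suc[OF v] simp del: dyadic_average.simps)
  qed
  also have "\<dots> \<le> (\<Sum>v\<in>subcorners a l. \<beta> * (\<integral>\<^sup>+x\<in>cell v (l / 2). w x \<partial>lebesgue)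
      + C * (\<integral>\<^sup>+x\<in>stopping_set k f c v (l / 2). F x \<partial>lebesgue))"
    by (intro sum_mono IH)
  also have "\<dots> = \<beta> * (\<Sum>v\<in>subcorners a l. \<integral>\<^sup>+x\<in>cell v (l / 2). w x \<partial>lebesgue)
      + C * (\<Sum>v\<in>subcorners a l. \<integral>\<^sup>+x\<in>stopping_set k f c v (l / 2). F x \<partial>lebesgue)"
    by (simp only: sum.distrib sum_distrib_left)
  also have "(\<Sum>v\<in>subcorners a l. \<integral>\<^sup>+x\<in>cell v (l / 2). w x \<partial>lebesgue) = (\<integral>\<^sup>+x\<in>cell a l. w x \<partial>lebesgue)"
    by (rule nn_integral_subcorners[OF \<open>l > 0\<close> w, symmetric])
  also have "(\<Sum>v\<in>subcorners a l. \<integral>\<^sup>+x\<in>stopping_set k f c v (l / 2). F x \<partial>lebesgue)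
      = (\<integral>\<^sup>+x\<in>stopping_set (Suc k) f c a l. F x \<partial>lebesgue)"
    using assms(2) nn_integral_UN_disjoint[OF F finite_subcorners disj] by simp
  finally show ?thesis .
qed

text \<open>
  A cell selected at the first opportunity has a parent whose average is within 2 of \<open>c\<close>. The
  average of the cell differs from that of its parent by at most \<open>2\<^sup>n\<close>, hence from \<open>c\<close> by at most this bound.
\<close>

definition jump_const :: real where "jump_const = 2 + 2 ^ CARD('n)"

text \<open>
  Descend from the cell until the stopping set is reached. Outside it the integrand is at most
  \<open>2 w\<close>. On a selected cell replace \<open>c\<close> by the average there, at the cost of at most \<open>jump_const\<close> times
  the weight, and use the assumed estimate for that cell, whose remaining depth is at most \<open>k\<close>.
\<close>

lemma oscillation_stopped:
  assumes "l > 0" and c: "\<bar>average f (cell a l) - c\<bar> \<le> jump_const"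
    and IH: "\<And>j a l. j \<le> k \<Longrightarrow> l > 0 \<Longrightarrow>
       (\<integral>\<^sup>+x\<in>cell a l. ennreal \<bar>dyadic_average j f a l x - average f (cell a l)\<bar> * w x \<partial>lebesgue)
       \<le> C * (\<integral>\<^sup>+x\<in>cell a l. F x \<partial>lebesgue)"
  shows "(\<integral>\<^sup>+x\<in>cell a l. ennreal \<bar>dyadic_average k f a l x - c\<bar> * w x \<partial>lebesgue)
     \<le> ennreal jump_const * (\<integral>\<^sup>+x\<in>cell a l. w x \<partial>lebesgue) + C * (\<integral>\<^sup>+x\<in>stopping_set k f c a l. F x \<partial>lebesgue)"
  using assms
proof (induction k arbitrary: a l)
  have stopped: "(\<integral>\<^sup>+x\<in>cell a l. ennreal \<bar>dyadic_average k f a l x - c\<bar> * w x \<partial>lebesgue)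
     \<le> ennreal jump_const * (\<integral>\<^sup>+x\<in>cell a l. w x \<partial>lebesgue) + C * (\<integral>\<^sup>+x\<in>stopping_set k f c a l. F x \<partial>lebesgue)"
    if "\<bar>average f (cell a l) - c\<bar> > 2" and c: "\<bar>average f (cell a l) - c\<bar> \<le> jump_const"
      and *: "(\<integral>\<^sup>+x\<in>cell a l. ennreal \<bar>dyadic_average k f a l x - average f (cell a l)\<bar> * w x \<partial>lebesgue)
       \<le> C * (\<integral>\<^sup>+x\<in>cell a l. F x \<partial>lebesgue)" for k a l
  proof -
    have "(\<integral>\<^sup>+x\<in>cell a l. ennreal \<bar>dyadic_average k f a l x - c\<bar> * w x \<partial>lebesgue)
       \<le> (\<integral>\<^sup>+x. ennreal jump_const * (w x * indicator (cell a l) x)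
          + ennreal \<bar>dyadic_average k f a l x - average f (cell a l)\<bar> * w x * indicator (cell a l) x \<partial>lebesgue)"
    proof (rule nn_integral_mono)
      fix x
      have "\<bar>dyadic_average k f a l x - c\<bar> \<le> jump_const + \<bar>dyadic_average k f a l x - average f (cell a l)\<bar>"
        using c by linarith
      moreover have "0 \<le> jump_const" using c by linarith
      ultimately have "ennreal \<bar>dyadic_average k f a l x - c\<bar> \<le> ennreal jump_const + ennreal \<bar>dyadic_average k f a l x - average f (cell a l)\<bar>"
        using ennreal_leI ennreal_plus by (metis abs_ge_zero)
      then have "ennreal \<bar>dyadic_average k f a l x - c\<bar> * (w x * indicator (cell a l) x)
          \<le> (ennreal jump_const + ennreal \<bar>dyadic_average k f a l x - average f (cell a l)\<bar>) * (w x * indicator (cell a l) x)"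
        by (rule mult_right_mono) simp
      then show "ennreal \<bar>dyadic_average k f a l x - c\<bar> * w x * indicator (cell a l) x
          \<le> ennreal jump_const * (w x * indicator (cell a l) x)
          + ennreal \<bar>dyadic_average k f a l x - average f (cell a l)\<bar> * w x * indicator (cell a l) x"
        by (simp only: distrib_right mult.assoc)
    qed
    also have "\<dots> = ennreal jump_const * (\<integral>\<^sup>+x\<in>cell a l. w x \<partial>lebesgue)
        + (\<integral>\<^sup>+x\<in>cell a l. ennreal \<bar>dyadic_average k f a l x - average f (cell a l)\<bar> * w x \<partial>lebesgue)"
      by (subst nn_integral_add) (auto simp: nn_integral_cmult)
    also have "\<dots> \<le> ennreal jump_const * (\<integral>\<^sup>+x\<in>cell a l. w x \<partial>lebesgue) + C * (\<integral>\<^sup>+x\<in>cell a l. F x \<partial>lebesgue)"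
      by (rule add_left_mono[OF *])
    finally show ?thesis by (simp only: stopping_set_all[OF that(1)])
  qed
  {
    case base: 0
    show ?case
    proof (cases "\<bar>average f (cell a l) - c\<bar> > 2")
      case True
      then show ?thesis using base.prems(2) base.prems(3)[OF order_refl base.prems(1)] by (rule stopped)
    next
      case False
      have "(\<integral>\<^sup>+x\<in>cell a l. ennreal \<bar>dyadic_average 0 f a l x - c\<bar> * w x \<partial>lebesgue)
          = ennreal \<bar>average f (cell a l) - c\<bar> * (\<integral>\<^sup>+x\<in>cell a l. w x \<partial>lebesgue)"
        by (simp add: mult.assoc nn_integral_cmult)
      also have "\<dots> \<le> ennreal jump_const * (\<integral>\<^sup>+x\<in>cell a l. w x \<partial>lebesgue)"
        using base.prems(2) by (intro mult_right_mono ennreal_leI) auto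
      finally show ?thesis using False by simp
    qed
  next
    case (Suc k)
    show ?case
    proof (cases "\<bar>average f (cell a l) - c\<bar> > 2")
      case True
      then show ?thesis using Suc.prems(2) Suc.prems(3)[OF order_refl Suc.prems(1)] by (rule stopped)
    next
      case False
      show ?thesis
      proof (rule oscillation_split[OF Suc.prems(1)])
        fix v assume v: "v \<in> subcorners a l"
        show "(\<integral>\<^sup>+x\<in>cell v (l / 2). ennreal \<bar>dyadic_average k f v (l / 2) x - c\<bar> * w x \<partial>lebesgue)
          \<le> ennreal jump_const * (\<integral>\<^sup>+x\<in>cell v (l / 2). w x \<partial>lebesgue) + C * (\<integral>\<^sup>+x\<in>stopping_set k f c v (l / 2). F x \<partial>lebesgue)"
        proof (rule Suc.IH)
          show "\<bar>average f (cell v (l / 2)) - c\<bar> \<le> jump_const"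
            using average_jump_le[OF Suc.prems(1) v] False unfolding jump_const_def by linarith
        qed (use Suc.prems in auto)
      qed (use False in simp)
    qed
  }
qed

text \<open>
  The stopping set fills at most half of the cell, and the average of \<open>w\<close> is at most \<open>F\<close> everywhere on the
  rest.
\<close>

lemma weight_le_outside_stopping_set:
  assumes "l > 0"
  shows "(\<integral>\<^sup>+x\<in>cell a l. w x \<partial>lebesgue)
     \<le> 2 * (\<integral>\<^sup>+x\<in>cell a l - stopping_set k f (average f (cell a l)) a l. F x \<partial>lebesgue)"
proof -
  define L where "L = l ^ CARD('n)"
  have L: "L > 0" using assms by (simp add: L_def)
  define U where "U = stopping_set k f (average f (cell a l)) a l"
  have U [measurable]: "U \<in> sets lebesgue" by (simp add: U_def)
  have Usub: "U \<subseteq> cell a l" unfolding U_def by (rule stopping_set_subset[OF assms])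
  define D where "D = cell a l - U"
  have [measurable]: "D \<in> sets lebesgue" by (simp add: D_def)
  have "2 * emeasure lebesgue U \<le> ennreal L"
    unfolding U_def L_def by (rule order_trans[OF emeasure_stopping_set_le[OF f assms] oscillation[OF assms]])
  moreover have "emeasure lebesgue D + emeasure lebesgue U = ennreal L"
  proof -
    have "emeasure lebesgue D + emeasure lebesgue U = emeasure lebesgue (D \<union> U)"
      by (rule plus_emeasure) (auto simp: D_def)
    also have "D \<union> U = cell a l" using Usub by (auto simp: D_def)
    finally show ?thesis using emeasure_cell[of l a] assms by (simp only: L_def less_imp_le)
  qed
  ultimately have half: "ennreal L \<le> 2 * emeasure lebesgue D"
  proof -
    assume 2: "2 * emeasure lebesgue U \<le> ennreal L"
      and eq: "emeasure lebesgue D + emeasure lebesgue U = ennreal L"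
    have fin: "emeasure lebesgue D < \<infinity>" "emeasure lebesgue U < \<infinity>"
      using eq by (metis ennreal_add_eq_top ennreal_neq_top infinity_ennreal_def top.not_eq_extremum)+
    obtain d u where du: "emeasure lebesgue D = ennreal d" "emeasure lebesgue U = ennreal u" "d \<ge> 0" "u \<ge> 0"
      using fin by (cases "emeasure lebesgue D"; cases "emeasure lebesgue U") (auto simp del: emeasure_completion)
    have "d + u = L" using eq L unfolding du(1,2) by (simp add: du(3,4) flip: ennreal_plus)
    moreover have "ennreal (2 * u) \<le> ennreal L" using 2 du(4) unfolding du(2) by (simp add: ennreal_mult)
    then have "2 * u \<le> L" using L by (simp add: ennreal_le_iff)
    ultimately have "ennreal L \<le> ennreal (2 * d)" by (intro ennreal_leI) linarith
    then show ?thesis using du(3) unfolding du(1) by (simp add: ennreal_mult)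
  qed
  have "ennreal L * (\<integral>\<^sup>+x\<in>cell a l. w x \<partial>lebesgue) \<le> 2 * emeasure lebesgue D * (\<integral>\<^sup>+x\<in>cell a l. w x \<partial>lebesgue)"
    by (rule mult_right_mono[OF half]) simp
  also have "\<dots> = 2 * (\<integral>\<^sup>+y\<in>D. (\<integral>\<^sup>+x\<in>cell a l. w x \<partial>lebesgue) \<partial>lebesgue)"
    by (subst nn_integral_cmult_indicator) (simp_all only: mult_ac \<open>D \<in> sets lebesgue\<close>)
  also have "\<dots> \<le> 2 * (\<integral>\<^sup>+y\<in>D. ennreal L * F y \<partial>lebesgue)"
    unfolding L_def
    by (intro mult_left_mono nn_integral_mono) (auto simp: D_def intro: average_le[OF assms] split: split_indicator)
  also have "\<dots> = ennreal L * (2 * (\<integral>\<^sup>+y\<in>D. F y \<partial>lebesgue))"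
    by (simp add: mult.assoc nn_integral_cmult mult.left_commute)
  finally have "ennreal (1 / L) * (ennreal L * (\<integral>\<^sup>+x\<in>cell a l. w x \<partial>lebesgue)) \<le> ennreal (1 / L) * (ennreal L * (2 * (\<integral>\<^sup>+y\<in>D. F y \<partial>lebesgue)))"
    by (rule mult_left_mono) simp
  then show ?thesis
    using L unfolding D_def U_def by (simp add: mult.assoc[symmetric] ennreal_mult[symmetric])
qed

text \<open>
  The root is never selected for \<open>c\<close> equal to its own average, so the estimates invoked on selected
  cells have strictly smaller depth. The weight term is absorbed by the integral of \<open>F\<close> outside the stopping
  set, which is the reason for the factor 2 and keeps the constant the same at every depth.
\<close>

theorem dyadic_oscillation_le:
  assumes "l > 0"
  shows "(\<integral>\<^sup>+x\<in>cell a l. ennreal \<bar>dyadic_average k f a l x - average f (cell a l)\<bar> * w x \<partial>lebesgue)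
       \<le> ennreal (2 * jump_const) * (\<integral>\<^sup>+x\<in>cell a l. F x \<partial>lebesgue)"
  using assms
proof (induction k arbitrary: a l rule: less_induct)
  case (less k)
  have jump_const: "jump_const \<ge> 0" by (simp add: jump_const_def)
  show ?case
  proof (cases k)
    case 0
    then show ?thesis by simp
  next
    case (Suc j)
    let ?c = "average f (cell a l)"
    let ?U = "stopping_set k f ?c a l"
    have "(\<integral>\<^sup>+x\<in>cell a l. ennreal \<bar>dyadic_average k f a l x - ?c\<bar> * w x \<partial>lebesgue)
       \<le> ennreal jump_const * (\<integral>\<^sup>+x\<in>cell a l. w x \<partial>lebesgue) + ennreal (2 * jump_const) * (\<integral>\<^sup>+x\<in>?U. F x \<partial>lebesgue)"
      unfolding Suc
    proof (rule oscillation_split[OF less.prems])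
      fix v assume v: "v \<in> subcorners a l"
      show "(\<integral>\<^sup>+x\<in>cell v (l / 2). ennreal \<bar>dyadic_average j f v (l / 2) x - ?c\<bar> * w x \<partial>lebesgue)
          \<le> ennreal jump_const * (\<integral>\<^sup>+x\<in>cell v (l / 2). w x \<partial>lebesgue)
            + ennreal (2 * jump_const) * (\<integral>\<^sup>+x\<in>stopping_set j f ?c v (l / 2). F x \<partial>lebesgue)"
      proof (rule oscillation_stopped)
        show "\<bar>average f (cell v (l / 2)) - ?c\<bar> \<le> jump_const"
          using average_jump_le[OF less.prems v] unfolding jump_const_def by linarith
      qed (use less Suc in auto)
    qed simp
    also have "\<dots> \<le> ennreal jump_const * (2 * (\<integral>\<^sup>+x\<in>cell a l - ?U. F x \<partial>lebesgue)) + ennreal (2 * jump_const) * (\<integral>\<^sup>+x\<in>?U. F x \<partial>lebesgue)"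
      by (intro add_right_mono mult_left_mono weight_le_outside_stopping_set less.prems) simp
    also have "\<dots> = ennreal (2 * jump_const) * ((\<integral>\<^sup>+x\<in>cell a l - ?U. F x \<partial>lebesgue) + (\<integral>\<^sup>+x\<in>?U. F x \<partial>lebesgue))"
      using jump_const by (simp add: ennreal_mult distrib_left mult_ac)
    also have "(\<integral>\<^sup>+x\<in>cell a l - ?U. F x \<partial>lebesgue) + (\<integral>\<^sup>+x\<in>?U. F x \<partial>lebesgue) = (\<integral>\<^sup>+x\<in>(cell a l - ?U) \<union> ?U. F x \<partial>lebesgue)"
      by (intro nn_integral_disjoint_pair[symmetric] F) auto
    also have "(cell a l - ?U) \<union> ?U = cell a l"
      using stopping_set_subset[OF less.prems] by blast
    finally show ?thesis .
  qed
qed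

end

section \<open>Lebesgue differentiation along cubes\<close>

lemma ccube_subset_ball:
  fixes x :: "real ^ 'n"
  assumes "x \<in> ccube a l" "real CARD('n) * l < d"
  shows "ccube a l \<subseteq> ball x d"
proof
  fix y assume y: "y \<in> ccube a l"
  have "norm (x - y) \<le> (\<Sum>i\<in>UNIV. \<bar>(x - y) $ i\<bar>)" by (rule norm_le_l1_cart)
  also have "\<dots> \<le> (\<Sum>i\<in>(UNIV :: 'n set). l)"
  proof (rule sum_mono)
    fix i
    show "\<bar>(x - y) $ i\<bar> \<le> l"
      using assms(1)[unfolded mem_ccube, rule_format, of i] y[unfolded mem_ccube, rule_format, of i]
      by (simp add: abs_le_iff)
  qed
  finally show "y \<in> ball x d" using assms(2) by (simp add: dist_norm)
qed

text \<open>
  Each bad point lies in a cube so small that it is admissible for the gauge of Henstock's lemma, while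
  the average over it is off by more than \<open>\<mu>\<close>. A disjoint subfamily forms a tagged partial division, so
  Henstock's lemma makes its total volume small. By the covering lemma it controls the measure of the bad set.
\<close>

lemma negligible_bad_averages:
  fixes f :: "real ^ 'n \<Rightarrow> real"
  assumes f: "f integrable_on cbox A B" and "\<mu> > 0"
  shows "negligible {x. \<forall>d>0. \<exists>a l. 0 < l \<and> l < d \<and> x \<in> ccube a l \<and> ccube a l \<subseteq> cbox A B \<and>
    \<mu> * l ^ CARD('n) < \<bar>l ^ CARD('n) * f x - integral (ccube a l) f\<bar>}" (is "negligible ?bad")
  unfolding negligible_outer_le
proof (intro allI impI)
  fix e :: real assume "e > 0"
  let ?K = "vitali_const TYPE('n)"
  have K: "?K \<ge> 1" by (rule vitali_const_ge_1)
  have n: "real CARD('n) > 0" using zero_less_card_finite[where 'a='n] by simp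
  obtain \<gamma> where "gauge \<gamma>"
    and \<gamma>: "\<And>p. p tagged_partial_division_of (cbox A B) \<Longrightarrow> \<gamma> fine p \<Longrightarrow>
             (\<Sum>(x,k)\<in>p. norm (Henstock_Kurzweil_Integration.content k *\<^sub>R f x - integral k f)) < e * \<mu> / ?K"
    using Henstock_lemma[OF f, of "e * \<mu> / ?K"] \<open>e > 0\<close> \<open>\<mu> > 0\<close> K by auto
  \<comment> \<open>The bound \<open>l < 1\<close> is there because the covering lemma needs bounded side lengths.\<close>
  define good where "good = (\<lambda>x (a, l). 0 < l \<and> l < 1 \<and> x \<in> ccube a l \<and> ccube a l \<subseteq> cbox A B \<and> ccube a l \<subseteq> \<gamma> x \<and>
    \<mu> * l ^ CARD('n) < \<bar>l ^ CARD('n) * f x - integral (ccube a l) f\<bar>)"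
  define I where "I = {i. \<exists>x. good x i}"
  define tag where "tag = (\<lambda>i. SOME x. good x i)"
  have tag: "good (tag i) i" if "i \<in> I" for i
    using that unfolding I_def tag_def by (auto intro: someI)
  have bad: "?bad \<subseteq> (\<Union>(a, l)\<in>I. ccube a l)"
  proof
    fix x assume x: "x \<in> ?bad"
    obtain d where d: "d > 0" "ball x d \<subseteq> \<gamma> x"
      using gaugeD[OF \<open>gauge \<gamma>\<close>, of x] openE by blast
    have "min 1 (d / real CARD('n)) > 0" using d n by simp
    then obtain a l where al: "0 < l" "l < min 1 (d / real CARD('n))" "x \<in> ccube a l" "ccube a l \<subseteq> cbox A B"
        "\<mu> * l ^ CARD('n) < \<bar>l ^ CARD('n) * f x - integral (ccube a l) f\<bar>"
      using x by blast
    have "real CARD('n) * l < d" using al(2) n by (simp add: pos_less_divide_eq mult.commute)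
    then have "ccube a l \<subseteq> \<gamma> x" using ccube_subset_ball[OF al(3)] d(2) by blast
    then have "good x (a, l)" using al by (simp add: good_def)
    then show "x \<in> (\<Union>(a, l)\<in>I. ccube a l)" using al(3) unfolding I_def by blast
  qed
  have bdd: "0 < l \<and> l \<le> 1" if "(a, l) \<in> I" for a l
    using tag[OF that] by (simp add: good_def)
  obtain C T where C: "countable C" "C \<subseteq> I" "disjoint_family_on (\<lambda>(a, l). ccube a l) C"
    "T \<in> sets lebesgue" "(\<Union>(a, l)\<in>I. ccube a l) \<subseteq> T"
    "emeasure lebesgue T \<le> ennreal ?K * emeasure lebesgue (\<Union>(a, l)\<in>C. ccube a l)"
    by (rule vitali_cubes[OF bdd])
  have finite_bound: "measure lebesgue (\<Union>i\<in>J. case i of (a, l) \<Rightarrow> ccube a l) \<le> e / ?K"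
    if J: "J \<subseteq> C" "finite J" for J
  proof -
    define cub where "cub = (\<lambda>i :: (real ^ 'n) \<times> real. case i of (a, l) \<Rightarrow> ccube a l)"
    have gJ: "good (tag i) i" if "i \<in> J" for i using tag that J C(2) by blast
    have disjJ: "cub i \<inter> cub j = {}" if "i \<in> J" "j \<in> J" "i \<noteq> j" for i j
      using disjoint_family_onD[OF C(3), of i j] that J by (auto simp: cub_def)
    have tagJ: "tag i \<in> cub i" if "i \<in> J" for i
      using gJ[OF that] by (auto simp: good_def cub_def split: prod.splits)
    let ?p = "(\<lambda>i. (tag i, cub i)) ` J"
    have inj: "inj_on (\<lambda>i. (tag i, cub i)) J"
    proof (rule inj_onI)
      fix i j assume ij: "i \<in> J" "j \<in> J" "(tag i, cub i) = (tag j, cub j)"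
      then have "tag i \<in> cub i \<inter> cub j" using tagJ[OF ij(1)] by simp
      then show "i = j" using disjJ[OF ij(1,2)] by auto
    qed
    have "?p tagged_partial_division_of cbox A B"
      unfolding tagged_partial_division_of_def
    proof (intro conjI allI impI)
      show "finite ?p" using J by simp
    next
      fix x L assume "(x, L) \<in> ?p"
      then obtain i where i: "i \<in> J" "x = tag i" "L = cub i" by auto
      then show "x \<in> L" "L \<subseteq> cbox A B" "\<exists>a b. L = cbox a b"
        using gJ[OF i(1)] by (auto simp: good_def cub_def split: prod.splits)
    next
      fix x1 L1 x2 L2 assume "(x1, L1) \<in> ?p \<and> (x2, L2) \<in> ?p \<and> (x1, L1) \<noteq> (x2, L2)"
      then obtain i j where ij: "i \<in> J" "j \<in> J" "L1 = cub i" "L2 = cub j" "i \<noteq> j" by auto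
      then have "L1 \<inter> L2 = {}" using disjJ by simp
      then show "interior L1 \<inter> interior L2 = {}"
        using interior_subset by blast
    qed
    moreover have "\<gamma> fine ?p"
      unfolding fine_def using gJ by (auto simp: good_def cub_def split: prod.splits)
    ultimately have sum_less: "(\<Sum>(x,k)\<in>?p. norm (Henstock_Kurzweil_Integration.content k *\<^sub>R f x - integral k f)) < e * \<mu> / ?K"
      by (rule \<gamma>)
    have "\<mu> * measure lebesgue (\<Union>i\<in>J. cub i) \<le> \<mu> * (\<Sum>i\<in>J. measure lebesgue (cub i))"
      using \<open>\<mu> > 0\<close> J(2)
      by (intro mult_left_mono measure_UNION_le) (auto simp: cub_def split: prod.splits)
    also have "\<dots> = (\<Sum>i\<in>J. \<mu> * measure lebesgue (cub i))" by (rule sum_distrib_left)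
    also have "\<dots> \<le> (\<Sum>i\<in>J. norm (measure lebesgue (cub i) *\<^sub>R f (tag i) - integral (cub i) f))"
    proof (rule sum_mono)
      fix i assume i: "i \<in> J"
      obtain a l where al: "i = (a, l)" by (cases i)
      have "l > 0" "\<mu> * l ^ CARD('n) < \<bar>l ^ CARD('n) * f (tag i) - integral (ccube a l) f\<bar>"
        using gJ[OF i] by (auto simp: al good_def)
      then show "\<mu> * measure lebesgue (cub i) \<le> norm (measure lebesgue (cub i) *\<^sub>R f (tag i) - integral (cub i) f)"
        using measure_ccube[of l a] by (simp add: al cub_def)
    qed
    also have "\<dots> = (\<Sum>(x,k)\<in>?p. norm (Henstock_Kurzweil_Integration.content k *\<^sub>R f x - integral k f))"
    proof -
      have "measure lebesgue (cub i) = measure lborel (cub i)" for i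
        by (cases i) (simp add: cub_def)
      then show ?thesis by (subst sum.reindex[OF inj]) (simp add: o_def)
    qed
    also note sum_less
    finally have "\<mu> * measure lebesgue (\<Union>i\<in>J. cub i) \<le> \<mu> * (e / ?K)" by (simp add: mult.commute)
    then show ?thesis using \<open>\<mu> > 0\<close> unfolding cub_def by (simp only: mult_le_cancel_left_pos)
  qed
  have cm: "(case i of (a, l) \<Rightarrow> ccube a l) \<in> lmeasurable" for i :: "(real ^ 'n) \<times> real"
    by (cases i) auto
  have lm: "(\<Union>(a, l)\<in>C. ccube a l) \<in> lmeasurable"
    using fmeasurable_UN_bound[OF C(1) cm finite_bound] .
  have mC: "measure lebesgue (\<Union>(a, l)\<in>C. ccube a l) \<le> e / ?K"
    using measure_UN_bound[OF C(1) cm finite_bound] .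
  have "emeasure lebesgue T \<le> ennreal ?K * ennreal (measure lebesgue (\<Union>(a, l)\<in>C. ccube a l))"
    using C(6) unfolding emeasure_eq_measure2[OF lm] .
  also have "\<dots> \<le> ennreal ?K * ennreal (e / ?K)"
    by (intro mult_left_mono ennreal_leI mC) simp
  also have "\<dots> = ennreal e"
    using K \<open>e > 0\<close> by (subst ennreal_mult[symmetric]) auto
  finally have eT: "emeasure lebesgue T \<le> ennreal e" .
  then have "T \<in> lmeasurable"
    using C(4) by (intro fmeasurableI) (auto intro: le_less_trans simp del: emeasure_completion)
  moreover have "measure lebesgue T \<le> e"
    using eT \<open>e > 0\<close> emeasure_eq_measure2[OF \<open>T \<in> lmeasurable\<close>] by simp
  ultimately show "\<exists>T. ?bad \<subseteq> T \<and> T \<in> lmeasurable \<and> measure lebesgue T \<le> e"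
    using subset_trans[OF bad C(5)] by (intro exI[of _ T] conjI)
qed

theorem lebesgue_differentiation_cubes:
  fixes f :: "real ^ 'n \<Rightarrow> real"
  assumes f: "locally_integrable f"
  shows "AE x in lebesgue. \<forall>e>0. \<exists>d>0. \<forall>a l. 0 < l \<longrightarrow> l < d \<longrightarrow> x \<in> ccube a l \<longrightarrow> ccube a l \<subseteq> cbox A B \<longrightarrow>
    \<bar>average f (ccube a l) - f x\<bar> \<le> e"
proof -
  define bad where "bad = (\<lambda>\<mu>. {x. \<forall>d>0. \<exists>a l. 0 < l \<and> l < d \<and> x \<in> ccube a l \<and> ccube a l \<subseteq> cbox A B \<and>
    \<mu> * l ^ CARD('n) < \<bar>l ^ CARD('n) * f x - integral (ccube a l) f\<bar>})"
  have si: "set_integrable lebesgue (cbox a b) f" for a b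
    using f unfolding locally_integrable_def by (metis compact_cbox)
  have "negligible (bad (inverse (real (Suc m))))" for m
    unfolding bad_def
    by (rule negligible_bad_averages[OF set_lebesgue_integral_eq_integral(1)[OF si]]) simp
  then have "negligible (\<Union>m. bad (inverse (real (Suc m))))"
    by (intro negligible_countable_Union) auto
  then have "AE x in lebesgue. x \<notin> (\<Union>m. bad (inverse (real (Suc m))))"
    by (intro AE_not_in) (simp add: negligible_iff_null_sets)
  then show ?thesis
  proof eventually_elim
    fix x assume x: "x \<notin> (\<Union>m. bad (inverse (real (Suc m))))"
    show "\<forall>e>0. \<exists>d>0. \<forall>a l. 0 < l \<longrightarrow> l < d \<longrightarrow> x \<in> ccube a l \<longrightarrow> ccube a l \<subseteq> cbox A B \<longrightarrow>
      \<bar>average f (ccube a l) - f x\<bar> \<le> e"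
    proof (intro allI impI)
      fix e :: real assume "e > 0"
      then obtain m where m: "inverse (real (Suc m)) < e" using reals_Archimedean by blast
      have "x \<notin> bad (inverse (real (Suc m)))" using x by blast
      then have "\<exists>d. 0 < d \<and> (\<forall>a l. \<not> (0 < l \<and> l < d \<and> x \<in> ccube a l \<and> ccube a l \<subseteq> cbox A B \<and>
          inverse (real (Suc m)) * l ^ CARD('n) < \<bar>l ^ CARD('n) * f x - integral (ccube a l) f\<bar>))"
        by (simp only: bad_def mem_Collect_eq not_all not_imp not_ex)
      then obtain d where d: "d > 0" "\<And>a l. \<not> (0 < l \<and> l < d \<and> x \<in> ccube a l \<and> ccube a l \<subseteq> cbox A B \<and>
          inverse (real (Suc m)) * l ^ CARD('n) < \<bar>l ^ CARD('n) * f x - integral (ccube a l) f\<bar>)"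
        by (elim exE conjE) (rule that, assumption, drule spec, drule spec, assumption)
      have "\<bar>average f (ccube a l) - f x\<bar> \<le> e"
        if al: "0 < l" "l < d" "x \<in> ccube a l" "ccube a l \<subseteq> cbox A B" for a l
      proof -
        let ?L = "l ^ CARD('n)"
        have L: "?L > 0" using al by simp
        have "average f (ccube a l) - f x = (integral (ccube a l) f - ?L * f x) / ?L"
          using L al(1) unfolding average_def set_lebesgue_integral_eq_integral(2)[OF si]
          by (subst measure_ccube) (auto simp: diff_divide_distrib)
        then have "\<bar>average f (ccube a l) - f x\<bar> = \<bar>?L * f x - integral (ccube a l) f\<bar> / ?L"
          using L by (simp add: abs_minus_commute)
        also have "\<dots> \<le> inverse (real (Suc m))"
          using d(2)[of l a] al L by (simp only: pos_divide_le_eq not_less simp_thms)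
        finally show ?thesis using m by linarith
      qed
      then show "\<exists>d>0. \<forall>a l. 0 < l \<longrightarrow> l < d \<longrightarrow> x \<in> ccube a l \<longrightarrow> ccube a l \<subseteq> cbox A B \<longrightarrow>
        \<bar>average f (ccube a l) - f x\<bar> \<le> e" using d(1) by blast
    qed
  qed
qed

section \<open>Bounding oscillations by the maximal function\<close>

lemma dyadic_average_eq_average:
  fixes f :: "real ^ 'n \<Rightarrow> real"
  assumes "l > 0" "x \<in> cell a l"
  shows "\<exists>v. ccube v (l / 2 ^ k) \<subseteq> ccube a l \<and> x \<in> cell v (l / 2 ^ k) \<and>
     dyadic_average k f a l x = average f (cell v (l / 2 ^ k))"
  using assms
proof (induction k arbitrary: a l)
  case 0
  then show ?case by auto
next
  case (Suc k)
  obtain u where u: "u \<in> subcorners a l" "x \<in> cell u (l / 2)"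
    using Suc.prems UN_subcorners[of l a] by blast
  obtain v where v: "ccube v (l / 2 / 2 ^ k) \<subseteq> ccube u (l / 2)" "x \<in> cell v (l / 2 / 2 ^ k)"
      "dyadic_average k f u (l / 2) x = average f (cell v (l / 2 / 2 ^ k))"
    using Suc.IH[of "l / 2" u] Suc.prems u by auto
  have "ccube u (l / 2) \<subseteq> ccube a l"
  proof
    fix y assume y: "y \<in> ccube u (l / 2)"
    have "a $ i \<le> y $ i \<and> y $ i \<le> a $ i + l" for i
      using y[unfolded mem_ccube, rule_format, of i] subcorners_nth[OF u(1), of i] Suc.prems(1) by auto
    then show "y \<in> ccube a l" by (simp add: mem_ccube)
  qed
  with v have "ccube v (l / 2 ^ Suc k) \<subseteq> ccube a l" "x \<in> cell v (l / 2 ^ Suc k)"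
    "dyadic_average (Suc k) f a l x = average f (cell v (l / 2 ^ Suc k))"
    using dyadic_average_Suc[OF u, of k f] by (auto simp del: dyadic_average.simps)
  then show ?case by blast
qed

lemma AE_dyadic_average_tendsto:
  fixes f :: "real ^ 'n \<Rightarrow> real"
  assumes f: "locally_integrable f" and "l > 0"
  shows "AE x in lebesgue. x \<in> cell a l \<longrightarrow> (\<lambda>k. dyadic_average k f a l x) \<longlonglongrightarrow> f x"
  using lebesgue_differentiation_cubes[OF f, where A=a and B="\<chi> i. a $ i + l"]
proof eventually_elim
  fix x assume D: "\<forall>e>0. \<exists>d>0. \<forall>b r. 0 < r \<longrightarrow> r < d \<longrightarrow> x \<in> ccube b r \<longrightarrow> ccube b r \<subseteq> ccube a l \<longrightarrow>
      \<bar>average f (ccube b r) - f x\<bar> \<le> e"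
  show "x \<in> cell a l \<longrightarrow> (\<lambda>k. dyadic_average k f a l x) \<longlonglongrightarrow> f x"
  proof
    assume x: "x \<in> cell a l"
    show "(\<lambda>k. dyadic_average k f a l x) \<longlonglongrightarrow> f x"
    proof (rule tendstoI)
      fix e :: real assume "e > 0"
      then obtain d where d: "d > 0" "\<And>b r. 0 < r \<Longrightarrow> r < d \<Longrightarrow> x \<in> ccube b r \<Longrightarrow> ccube b r \<subseteq> ccube a l \<Longrightarrow>
          \<bar>average f (ccube b r) - f x\<bar> \<le> e / 2"
        using D[rule_format, of "e / 2"] by auto
      have "(\<lambda>k. l * (1 / 2) ^ k) \<longlonglongrightarrow> l * 0"
        by (intro tendsto_mult tendsto_const LIMSEQ_power_zero) simp
      then have "\<forall>\<^sub>F k in sequentially. l * (1 / 2) ^ k < d"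
        using d(1) by (intro order_tendstoD(2)[of _ 0]) auto
      then show "\<forall>\<^sub>F k in sequentially. dist (dyadic_average k f a l x) (f x) < e"
      proof eventually_elim
        fix k assume k: "l * (1 / 2) ^ k < d"
        obtain v where v: "ccube v (l / 2 ^ k) \<subseteq> ccube a l" "x \<in> cell v (l / 2 ^ k)"
           "dyadic_average k f a l x = average f (cell v (l / 2 ^ k))"
          using dyadic_average_eq_average[OF \<open>l > 0\<close> x] by blast
        have "average f (cell v (l / 2 ^ k)) = average f (ccube v (l / 2 ^ k))"
          using \<open>l > 0\<close> by (intro average_cell_eq f) simp
        moreover have "\<bar>average f (ccube v (l / 2 ^ k)) - f x\<bar> \<le> e / 2"
          using v k \<open>l > 0\<close> cell_subset_ccube by (intro d(2)) (auto simp: power_divide)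
        ultimately show "dist (dyadic_average k f a l x) (f x) < e"
          using \<open>e > 0\<close> v(3) by (simp add: dist_real_def)
      qed
    qed
  qed
qed

text \<open>
  The dyadic estimate for the weight \<open>w \<chi>\<^sub>Q\<close> holds uniformly in the generation \<open>k\<close>, and the dyadic averages converge to
  \<open>f\<close> almost everywhere, so Fatou's lemma applies.
\<close>

lemma weighted_oscillation_le_hl_maximal:
  fixes f w :: "real ^ 'n \<Rightarrow> real"
  assumes f: "locally_integrable f" and bmo: "bmo_norm f \<le> 1"
    and w: "locally_integrable w" and w0: "\<And>x. 0 \<le> w x" and "L > 0"
  shows "(\<integral>\<^sup>+x\<in>ccube b L. ennreal (\<bar>f x - average f (ccube b L)\<bar> * w x) \<partial>lebesgue)
    \<le> ennreal (2 * (2 + 2 ^ CARD('n))) * (\<integral>\<^sup>+x\<in>ccube b L. hl_maximal (\<lambda>y. w y * indicator (ccube b L) y) x \<partial>lebesgue)"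
proof -
  define g where "g = (\<lambda>y. w y * indicator (ccube b L) y)"
  have g0: "g x \<ge> 0" for x using w0 by (simp add: g_def)
  have gm [measurable]: "g \<in> borel_measurable lebesgue"
    unfolding g_def by (rule set_integrable_measurable[OF set_integrable_ccube[OF w]])
  note [measurable] = locally_integrable_borel_measurable[OF f]
  interpret dyadic_testing f "\<lambda>x. ennreal (g x)" "hl_maximal g"
  proof
    show "locally_integrable f" by fact
    show "(\<integral>\<^sup>+x\<in>cell a l. ennreal \<bar>f x - average f (cell a l)\<bar> \<partial>lebesgue) \<le> ennreal (l ^ CARD('n))"
      if "l > 0" for a l
    proof -
      let ?I = "\<integral>\<^sup>+x\<in>ccube a l. ennreal \<bar>f x - average f (ccube a l)\<bar> \<partial>lebesgue"
      have "?I / emeasure lebesgue (ccube a l) \<le> bmo_norm f"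
        unfolding bmo_norm_def by (intro SUP_upper) (simp add: cube_ccube that)
      then have "?I / ennreal (l ^ CARD('n)) \<le> 1"
        using bmo emeasure_ccube[of l a] that by (auto simp del: emeasure_completion)
      then have "?I \<le> ennreal (l ^ CARD('n))"
        using less_divide_ennreal[of "l ^ CARD('n)" 1 ?I] that by (simp add: not_less[symmetric])
      then show ?thesis
        unfolding nn_integral_cell_eq average_cell_eq[OF f less_imp_le[OF that]] .
    qed
    show "(\<integral>\<^sup>+y\<in>cell a l. ennreal (g y) \<partial>lebesgue) \<le> ennreal (l ^ CARD('n)) * hl_maximal g x"
      if "l > 0" "x \<in> cell a l" for a l x
      using average_le_hl_maximal[OF that(1) subsetD[OF cell_subset_ccube that(2)], of g]
      unfolding nn_integral_cell_eq by (simp only: abs_of_nonneg[OF g0])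
    show "(\<lambda>x. ennreal (g x)) \<in> borel_measurable lebesgue" by measurable
    show "hl_maximal g \<in> borel_measurable lebesgue" by (rule borel_measurable_hl_maximal)
  qed
  let ?c = "average f (cell b L)"
  define u where "u = (\<lambda>k x. ennreal \<bar>dyadic_average k f b L x - ?c\<bar> * ennreal (g x) * indicator (cell b L) x)"
  have um: "u k \<in> borel_measurable lebesgue" for k unfolding u_def by measurable
  have lim: "AE x in lebesgue. ennreal (\<bar>f x - ?c\<bar> * g x) * indicator (cell b L) x = liminf (\<lambda>k. u k x)"
    using AE_dyadic_average_tendsto[OF f \<open>L > 0\<close>, of b]
  proof eventually_elim
    fix x assume x: "x \<in> cell b L \<longrightarrow> (\<lambda>k. dyadic_average k f b L x) \<longlonglongrightarrow> f x"
    show "ennreal (\<bar>f x - ?c\<bar> * g x) * indicator (cell b L) x = liminf (\<lambda>k. u k x)"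
    proof (cases "x \<in> cell b L")
      case True
      then have "(\<lambda>k. dyadic_average k f b L x) \<longlonglongrightarrow> f x" using x by blast
      then have "(\<lambda>k. \<bar>dyadic_average k f b L x - ?c\<bar> * g x) \<longlonglongrightarrow> \<bar>f x - ?c\<bar> * g x"
        by (intro tendsto_intros)
      then have "(\<lambda>k. ennreal (\<bar>dyadic_average k f b L x - ?c\<bar> * g x)) \<longlonglongrightarrow> ennreal (\<bar>f x - ?c\<bar> * g x)"
        by (rule tendsto_ennrealI)
      then have "liminf (\<lambda>k. ennreal (\<bar>dyadic_average k f b L x - ?c\<bar> * g x)) = ennreal (\<bar>f x - ?c\<bar> * g x)"
        by (intro lim_imp_Liminf) auto
      then show ?thesis using True g0[of x] by (simp add: u_def ennreal_mult)
    next
      case False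
      then show ?thesis by (simp add: u_def Liminf_const)
    qed
  qed
  have "(\<integral>\<^sup>+x\<in>ccube b L. ennreal (\<bar>f x - average f (ccube b L)\<bar> * w x) \<partial>lebesgue)
     = (\<integral>\<^sup>+x\<in>ccube b L. ennreal (\<bar>f x - ?c\<bar> * g x) \<partial>lebesgue)"
    unfolding average_cell_eq[OF f less_imp_le[OF \<open>L > 0\<close>]]
    by (intro nn_integral_cong) (auto simp: g_def split: split_indicator)
  also have "\<dots> = (\<integral>\<^sup>+x\<in>cell b L. ennreal (\<bar>f x - ?c\<bar> * g x) \<partial>lebesgue)"
    by (rule nn_integral_cell_eq[symmetric])
  also have "\<dots> = (\<integral>\<^sup>+x. liminf (\<lambda>k. u k x) \<partial>lebesgue)"
    by (rule nn_integral_cong_AE[OF lim])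
  also have "\<dots> \<le> liminf (\<lambda>k. integral\<^sup>N lebesgue (u k))"
    by (rule nn_integral_liminf[OF um])
  also have "\<dots> \<le> limsup (\<lambda>k. integral\<^sup>N lebesgue (u k))"
    by (intro Liminf_le_Limsup) simp
  also have "\<dots> \<le> ennreal (2 * jump_const) * (\<integral>\<^sup>+x\<in>cell b L. hl_maximal g x \<partial>lebesgue)"
    unfolding u_def by (intro Limsup_bounded always_eventually allI dyadic_oscillation_le \<open>L > 0\<close>)
  finally show ?thesis unfolding nn_integral_cell_eq jump_const_def g_def .
qed

lemma cp_bmo_const_le_cp_const:
  fixes w :: "real ^ 'n \<Rightarrow> real"
  assumes w: "locally_integrable w" and w0: "\<And>x. 0 \<le> w x"
  shows "cp_bmo_const p w \<le> ennreal (2 * (2 + 2 ^ CARD('n))) * cp_const p w"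
  unfolding cp_bmo_const_def
proof (intro SUP_least)
  fix f :: "real ^ 'n \<Rightarrow> real" and Q :: "(real ^ 'n) set"
  assume "f \<in> {f. locally_integrable f \<and> bmo_norm f = 1}" and "Q \<in> {Q. cube Q}"
  then have f: "locally_integrable f" "bmo_norm f \<le> 1" and Q: "cube Q" by auto
  obtain b l where bl: "l > 0" "Q = ccube b l" using Q by (rule cubeE)
  have "1 / cp_mass p w Q * (\<integral>\<^sup>+x\<in>Q. ennreal (\<bar>f x - average f Q\<bar> * w x) \<partial>lebesgue)
     \<le> 1 / cp_mass p w Q * (ennreal (2 * (2 + 2 ^ CARD('n))) *
        (\<integral>\<^sup>+x\<in>Q. hl_maximal (\<lambda>y. w y * indicator Q y) x \<partial>lebesgue))"
    unfolding bl(2) by (intro mult_left_mono weighted_oscillation_le_hl_maximal f w w0 bl(1)) simp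
  also have "\<dots> = ennreal (2 * (2 + 2 ^ CARD('n))) * (1 / cp_mass p w Q *
        (\<integral>\<^sup>+x\<in>Q. hl_maximal (\<lambda>y. w y * indicator Q y) x \<partial>lebesgue))"
    by (rule mult.left_commute)
  also have "\<dots> \<le> ennreal (2 * (2 + 2 ^ CARD('n))) * cp_const p w"
    unfolding cp_const_def using Q by (intro mult_left_mono SUP_upper) auto
  finally show "1 / cp_mass p w Q * (\<integral>\<^sup>+x\<in>Q. ennreal (\<bar>f x - average f Q\<bar> * w x) \<partial>lebesgue)
     \<le> ennreal (2 * (2 + 2 ^ CARD('n))) * cp_const p w" .
qed

section \<open>Comparability of the two constants\<close>

theorem corollary2p5:
  shows "\<exists>C::real. C > 0 \<and>
    (\<forall>(w :: real ^ 'n \<Rightarrow> real) (p::real).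
       weight w \<and> p > 1 \<and> (\<forall>Q. cube Q \<longrightarrow> cp_mass p w Q < \<infinity>) \<longrightarrow>
         cp_const p w \<le> ennreal C * cp_bmo_const p w \<and>
         cp_bmo_const p w \<le> ennreal C * cp_const p w)"
proof -
  define C1 :: real where "C1 = 4 * (1 + 4 * (vitali_const TYPE('n))\<^sup>2)
      + 8 * vitali_const TYPE('n) * (vitali_const TYPE('n) * 3 ^ CARD('n))"
  define C2 :: real where "C2 = 2 * (2 + 2 ^ CARD('n))"
  have C2: "C2 > 0" by (simp add: C2_def add_pos_pos)
  show ?thesis
  proof (intro exI[of _ "max C1 C2"] conjI allI impI)
    show "max C1 C2 > 0" using C2 by simp
  next
    fix w :: "real ^ 'n \<Rightarrow> real" and p :: real
    assume "weight w \<and> p > 1 \<and> (\<forall>Q. cube Q \<longrightarrow> cp_mass p w Q < \<infinity>)"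
    then have w: "locally_integrable w" "\<And>x. 0 \<le> w x" by (auto simp: weight_def)
    have "cp_const p w \<le> ennreal C1 * cp_bmo_const p w"
      unfolding C1_def by (rule cp_const_le_cp_bmo_const[OF w])
    also have "\<dots> \<le> ennreal (max C1 C2) * cp_bmo_const p w"
      by (intro mult_right_mono ennreal_leI) auto
    finally show "cp_const p w \<le> ennreal (max C1 C2) * cp_bmo_const p w" .
    have "cp_bmo_const p w \<le> ennreal C2 * cp_const p w"
      unfolding C2_def by (rule cp_bmo_const_le_cp_const[OF w])
    also have "\<dots> \<le> ennreal (max C1 C2) * cp_const p w"
      by (intro mult_right_mono ennreal_leI) auto
    finally show "cp_bmo_const p w \<le> ennreal (max C1 C2) * cp_const p w" .
  qed
qed

end
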